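(* Let $G$ be a digraph on a finite vertex set $N$ and let $\mathfrak{G}\subseteq\operatorname{Aut}(G)$ be a subgroup. For every $k\in\mathbb{N}$, the quasisymmetric class function $[t^k]\chi(G,\mathfrak{G},t,\mathbf{x})$ is $F$-effective. Moreover, for every irreducible character $\psi$ of $\mathfrak{G}$, the quasisymmetric function $\langle\psi,[t^k]\chi(G,\mathfrak{G},t,\mathbf{x})\rangle$ is $F$-positive.
   Context: A digraph on $N$ has at most one directed edge between any two vertices. A coloring of $G$ is a map $f:N\to\{1,2,\dots\}$ with $f(u)\ne f(v)$ for every edge $(u,v)$; $\operatorname{asc}(f)$ is the number of edges $(u,v)$ with $f(u)>f(v)$ (the paper calls this the number of $f$-descents). An automorphism of $G$ is a bijection $\mathfrak{g}:N\to N$ with $(u,v)\in E(G)\iff(\mathfrak{g}u,\mathfrak{g}v)\in E(G)$. For $\mathfrak{g}\in\mathfrak{G}$, $\chi(G,\mathfrak{G},t,\mathbf{x};\mathfrak{g})=\sum_f t^{\operatorname{asc}(f)}\prod_{v\in N}x_{f(v)}$, summed over colorings with $f\circ\mathfrak{g}=f$; this is a class function on $\mathfrak{G}$ with values in quasisymmetric functions over $\mathbb{C}[t]$, and $[t^k]$ extracts the coefficient of $t^k$, a class function with values in $\mathrm{QSym}$. Integer compositions are ordered by refinement ($\alpha\le\beta$ iff $\beta$ refines $\alpha$); $M_\alpha=\sum_{i_1<\dots<i_k}x_{i_1}^{\alpha_1}\cdots x_{i_k}^{\alpha_k}$ and $F_\alpha=\sum_{\beta\ge\alpha}M_\beta$.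 A $\mathrm{QSym}$-valued class function $\chi=\sum_\alpha\psi_\alpha F_\alpha$ is $F$-effective if every $\psi_\alpha$ is an effective character (nonnegative integer combination of irreducible characters). For a class function $\chi$ with values in $\mathrm{QSym}$ and a character $\psi$, $\langle\psi,\chi\rangle=\frac1{|\mathfrak{G}|}\sum_{\mathfrak{g}\in\mathfrak{G}}\overline{\psi(\mathfrak{g})}\chi(\mathfrak{g})\in\mathrm{QSym}$. A quasisymmetric function is $F$-positive if its coefficients in the $F$-basis are nonnegative. *)

theory Defs
  imports
    "HOL-Algebra.Bij"
    "HOL-Library.Poly_Mapping"
    "HOL-Library.Nonpos_Ints"
    "HOL-Computational_Algebra.Polynomial"
    "Jordan_Normal_Form.VS_Connect"
    "Graph_Theory.Pair_Digraph"
begin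

section \<open>Complex characters of a group\<close>

definition GL :: "nat \<Rightarrow> complex mat monoid" where
  "GL n = units_of (ring_mat TYPE(complex) n ())"

definition mat_trace :: "'a::comm_monoid_add mat \<Rightarrow> 'a" where
  "mat_trace A = (\<Sum>i<dim_row A. A $$ (i, i))"

definition representation :: "('g, 'm) monoid_scheme \<Rightarrow> nat \<Rightarrow> ('g \<Rightarrow> complex mat) \<Rightarrow> bool" where
  "representation \<G> n \<rho> \<longleftrightarrow> \<rho> \<in> hom \<G> (GL n)"

definition irreducible_representation ::
    "('g, 'm) monoid_scheme \<Rightarrow> nat \<Rightarrow> ('g \<Rightarrow> complex mat) \<Rightarrow> bool" where
  "irreducible_representation \<G> n \<rho> \<longleftrightarrow>
     representation \<G> n \<rho> \<and> n > 0 \<and>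
     (\<forall>W. VectorSpace.subspace class_ring W (module_vec TYPE(complex) n) \<and>
           (\<forall>g\<in>carrier \<G>. \<forall>w\<in>W. \<rho> g *\<^sub>v w \<in> W) \<longrightarrow>
           W = {0\<^sub>v n} \<or> W = carrier_vec n)"

text \<open>Functions on the group are restricted to its carrier, so that equal characters are equal
  as HOL functions.\<close>

definition irreducible_characters :: "('g, 'm) monoid_scheme \<Rightarrow> ('g \<Rightarrow> complex) set" where
  "irreducible_characters \<G> =
     {restrict (\<lambda>g. mat_trace (\<rho> g)) (carrier \<G>) | n \<rho>. irreducible_representation \<G> n \<rho>}"

definition effective_character :: "('g, 'm) monoid_scheme \<Rightarrow> ('g \<Rightarrow> complex) \<Rightarrow> bool" where
  "effective_character \<G> \<psi> \<longleftrightarrow>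
     (\<exists>S (m :: ('g \<Rightarrow> complex) \<Rightarrow> nat). finite S \<and> S \<subseteq> irreducible_characters \<G> \<and>
        (\<forall>g\<in>carrier \<G>. \<psi> g = (\<Sum>\<eta>\<in>S. of_nat (m \<eta>) * \<eta> g)))"


section \<open>Quasisymmetric functions\<close>

text \<open>A formal power series in \<open>x\<^sub>1, x\<^sub>2, \<dots>\<close> is given by its coefficient function on monomials; a
  monomial is a finitely supported map from variable indices to exponents. The index \<open>0\<close> is never
  used.\<close>

type_synonym monomial = "nat \<Rightarrow>\<^sub>0 nat"

type_synonym 'a series = "monomial \<Rightarrow> 'a"

definition composition :: "nat list \<Rightarrow> bool" where
  "composition \<alpha> \<longleftrightarrow> (\<forall>a\<in>set \<alpha>. a > 0)"

text \<open>\<open>\<beta>\<close> refines \<open>\<alpha>\<close> if \<open>\<beta>\<close> splits into consecutive blocks whose sums are the parts of \<open>\<alpha>\<close>.\<close>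

definition comp_le :: "nat list \<Rightarrow> nat list \<Rightarrow> bool" where
  "comp_le \<alpha> \<beta> \<longleftrightarrow> (\<exists>bs. concat bs = \<beta> \<and> map sum_list bs = \<alpha>)"

text \<open>The coefficient of a monomial in \<open>M\<^sub>\<alpha>\<close> is the number of index sequences
  \<open>i\<^sub>1 < \<dots> < i\<^sub>k\<close> contributing that monomial to the sum (which is \<open>0\<close> or \<open>1\<close>).\<close>

definition qsym_M :: "nat list \<Rightarrow> complex series" where
  "qsym_M \<alpha> = (\<lambda>m. of_nat (card {i :: nat list.
      length i = length \<alpha> \<and> sorted_wrt (<) i \<and> (\<forall>j\<in>set i. j \<ge> 1) \<and>
      (\<Sum>j<length \<alpha>. Poly_Mapping.single (i ! j) (\<alpha> ! j)) = m}))"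

definition qsym_F :: "nat list \<Rightarrow> complex series" where
  "qsym_F \<alpha> = (\<lambda>m. \<Sum>\<beta> | composition \<beta> \<and> comp_le \<alpha> \<beta>. qsym_M \<beta> m)"

text \<open>\<open>q = \<Sum>\<^sub>\<alpha> c\<^sub>\<alpha> F\<^sub>\<alpha>\<close>, a finite linear combination; in particular \<open>q\<close> is quasisymmetric.
  Only the values of \<open>c\<close> on compositions matter.\<close>

definition F_expansion :: "complex series \<Rightarrow> (nat list \<Rightarrow> complex) \<Rightarrow> bool" where
  "F_expansion q c \<longleftrightarrow>
     finite {\<alpha>. composition \<alpha> \<and> c \<alpha> \<noteq> 0} \<and>
     q = (\<lambda>m. \<Sum>\<alpha> | composition \<alpha> \<and> c \<alpha> \<noteq> 0. c \<alpha> * qsym_F \<alpha> m)"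

definition F_positive :: "complex series \<Rightarrow> bool" where
  "F_positive q \<longleftrightarrow>
     (\<exists>c. F_expansion q c \<and> (\<forall>\<alpha>. composition \<alpha> \<longrightarrow> c \<alpha> \<in> \<real>\<^sub>\<ge>\<^sub>0))"

text \<open>A quasisymmetric class function is a map from the group to power series; that it is constant on
  conjugacy classes and takes quasisymmetric values follows from the expansion required here.\<close>

definition F_effective :: "('g, 'm) monoid_scheme \<Rightarrow> ('g \<Rightarrow> complex series) \<Rightarrow> bool" where
  "F_effective \<G> \<chi> \<longleftrightarrow>
     (\<exists>\<psi> :: nat list \<Rightarrow> 'g \<Rightarrow> complex.
        (\<forall>\<alpha>. composition \<alpha> \<longrightarrow> effective_character \<G> (\<psi> \<alpha>)) \<and>
        (\<forall>g\<in>carrier \<G>. F_expansion (\<chi> g) (\<lambda>\<alpha>. \<psi> \<alpha> g)))"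

definition char_inner ::
    "('g, 'm) monoid_scheme \<Rightarrow> ('g \<Rightarrow> complex) \<Rightarrow> ('g \<Rightarrow> complex series) \<Rightarrow> complex series" where
  "char_inner \<G> \<psi> \<chi> =
     (\<lambda>m. 1 / of_nat (card (carrier \<G>)) * (\<Sum>g\<in>carrier \<G>. cnj (\<psi> g) * \<chi> g m))"


section \<open>Colorings of a digraph\<close>

text \<open>As with \<open>Bij\<close>, maps on the vertex set are extensional, i.e. \<open>undefined\<close> outside of it.\<close>

definition digraph_aut :: "'a pair_pre_digraph \<Rightarrow> ('a \<Rightarrow> 'a) set" where
  "digraph_aut G = {g \<in> Bij (pverts G).
     \<forall>u\<in>pverts G. \<forall>v\<in>pverts G. (u, v) \<in> parcs G \<longleftrightarrow> (g u, g v) \<in> parcs G}"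

definition digraph_aut_group :: "'a pair_pre_digraph \<Rightarrow> ('a \<Rightarrow> 'a) monoid" where
  "digraph_aut_group G = (BijGroup (pverts G)) \<lparr>carrier := digraph_aut G\<rparr>"

definition colorings :: "'a pair_pre_digraph \<Rightarrow> ('a \<Rightarrow> nat) set" where
  "colorings G = {f \<in> pverts G \<rightarrow>\<^sub>E {1..}. \<forall>(u, v)\<in>parcs G. f u \<noteq> f v}"

definition asc :: "'a pair_pre_digraph \<Rightarrow> ('a \<Rightarrow> nat) \<Rightarrow> nat" where
  "asc G f = card {(u, v) \<in> parcs G. f u > f v}"

definition color_monomial :: "'a pair_pre_digraph \<Rightarrow> ('a \<Rightarrow> nat) \<Rightarrow> monomial" where
  "color_monomial G f = (\<Sum>v\<in>pverts G. Poly_Mapping.single (f v) 1)"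

text \<open>\<open>chromatic G g\<close> is the value at \<open>g\<close> of the chromatic class function, a power series with
  coefficients in \<open>\<complex>[t]\<close>; only finitely many colorings contribute to a given monomial.\<close>

definition chromatic :: "'a pair_pre_digraph \<Rightarrow> ('a \<Rightarrow> 'a) \<Rightarrow> complex poly series" where
  "chromatic G g = (\<lambda>m. \<Sum>f | f \<in> colorings G \<and> compose (pverts G) f g = f \<and>
      color_monomial G f = m. monom 1 (asc G f))"

definition t_coeff :: "nat \<Rightarrow> ('g \<Rightarrow> complex poly series) \<Rightarrow> 'g \<Rightarrow> complex series" where
  "t_coeff k \<chi> = (\<lambda>g m. poly.coeff (\<chi> g m) k)"

end

theory Submission
  imports Defs
begin

text \<open>A coloring \<open>f\<close> with \<open>k\<close> ascents is determined by its monomial and by any numbering of the vertices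
  by \<open>1, \<dots>, n\<close> refining it, and such a numbering is itself a coloring with \<open>k\<close> ascents. On the space of
  complex functions on the set \<open>X\<close> of these numberings, the colorings with a given monomial \<open>m\<close> therefore
  span an invariant subspace \<open>V S\<close>, where \<open>S\<close> is the set of partial sums of the exponents of \<open>m\<close>, and the
  number of such colorings fixed by an automorphism is its trace on \<open>V S\<close>.

  Labelling the vertices suitably on each acyclic orientation, every \<open>w \<in> X\<close> has a descent set \<open>D w\<close> and
  a function \<open>e w\<close>, the indicator of the numberings with the same level sets as \<open>w\<close> at the elements of
  \<open>D w\<close>. The \<open>e w\<close> are unitriangular, and those with \<open>D w \<subseteq> S\<close> form a basis of \<open>V S\<close>, for all \<open>S\<close> at once.
  Hence the group acts in the basis \<open>e\<close> by matrices that are block triangular with respect to \<open>D\<close>; the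
  diagonal block of the descent set with composition \<open>\<alpha>\<close> is a representation, and its character is the
  coefficient of \<open>F\<^sub>\<alpha>\<close>. The second claim follows because the inner product of two irreducible characters
  is the trace of a projection.\<close>

text \<open>The obstacle is equivariance. The reference numbering is an arbitrary choice for each
  acyclic orientation, and automorphisms need not respect these choices; they need not preserve
  \<open>D\<close> or permute the functions \<open>e w\<close>, so no coefficient is visibly a
  permutation character. What every automorphism does preserve is the whole family of spaces
  \<open>V S\<close>, hence the filtration by descent sets, and the coefficients live on its graded
  pieces.

  The fundamental basis fits because the coefficient of a monomial of the right degree in
  \<open>qsym_F \<alpha>\<close> only asks whether the partial sums of \<open>\<alpha>\<close> are
  among those of the exponents. Summing diagonal entries over \<open>D w \<subseteq> S\<close> is
  therefore already an expansion in fundamentals.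

  The labelling has to run against a linear extension: an arc with no descent between its ends would
  be ordered by \<open>w\<close> against its own orientation. So the levels in \<open>D w\<close>
  separate the ends of every arc and determine the orientation, which is what puts
  \<open>e w\<close> into \<open>V (D w)\<close>.\<close>

section \<open>Representations on functions on a finite set\<close>

text \<open>A matrix representation indexed by an arbitrary finite set, so that blocks of it are representations
  without any renumbering. Entries outside \<open>I \<times> I\<close> are irrelevant.\<close>

definition kernel_rep :: "('g, 'm) monoid_scheme \<Rightarrow> 'i set \<Rightarrow> ('g \<Rightarrow> 'i \<Rightarrow> 'i \<Rightarrow> complex) \<Rightarrow> bool"
  where "kernel_rep \<G> I a \<longleftrightarrow> finite I \<and>
     (\<forall>i\<in>I. \<forall>j\<in>I. a \<one>\<^bsub>\<G>\<^esub> i j = of_bool (i = j)) \<and>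
     (\<forall>g\<in>carrier \<G>. \<forall>h\<in>carrier \<G>. \<forall>i\<in>I. \<forall>j\<in>I.
        a (g \<otimes>\<^bsub>\<G>\<^esub> h) i j = (\<Sum>l\<in>I. a g i l * a h l j))"

definition apply_on :: "'i set \<Rightarrow> ('i \<Rightarrow> 'i \<Rightarrow> complex) \<Rightarrow> ('i \<Rightarrow> complex) \<Rightarrow> 'i \<Rightarrow> complex"
  where "apply_on I A \<phi> i = (\<Sum>l\<in>I. A i l * \<phi> l)"

text \<open>The last clause makes membership depend only on the values on \<open>I\<close>. Total
  functions can then stand for functions on \<open>I\<close>, and the full space is
  \<open>UNIV\<close>.\<close>

definition subspace_on :: "'i set \<Rightarrow> ('i \<Rightarrow> complex) set \<Rightarrow> bool"
  where "subspace_on I W \<longleftrightarrow> (\<lambda>_. 0) \<in> W \<and>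
     (\<forall>\<phi>\<in>W. \<forall>\<psi>\<in>W. \<forall>c. (\<lambda>i. \<phi> i + c * \<psi> i) \<in> W) \<and>
     (\<forall>\<phi>\<in>W. \<forall>\<psi>. (\<forall>i\<in>I. \<psi> i = \<phi> i) \<longrightarrow> \<psi> \<in> W)"

text \<open>Restriction to the coordinates in \<open>J\<close> maps \<open>W\<close> isomorphically to \<open>\<complex>\<^sup>J\<close>, and \<open>b\<close> is the preimage of the
  standard basis; the coordinates outside \<open>J\<close> then describe the quotient by \<open>W\<close>.\<close>

definition reduced_basis :: "'i set \<Rightarrow> ('i \<Rightarrow> complex) set \<Rightarrow> 'i set \<Rightarrow> ('i \<Rightarrow> 'i \<Rightarrow> complex) \<Rightarrow> bool"
  where "reduced_basis I W J b \<longleftrightarrow> J \<subseteq> I \<and>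
     (\<forall>j\<in>J. b j \<in> W \<and> (\<forall>i\<in>J. b j i = of_bool (i = j))) \<and>
     (\<forall>\<phi>\<in>W. \<forall>i\<in>I. \<phi> i = (\<Sum>j\<in>J. \<phi> j * b j i))"

lemma reduced_basisD:
  assumes "reduced_basis I W J b"
  shows "J \<subseteq> I"
    and "j \<in> J \<Longrightarrow> b j \<in> W"
    and "j \<in> J \<Longrightarrow> i \<in> J \<Longrightarrow> b j i = of_bool (i = j)"
    and "\<phi> \<in> W \<Longrightarrow> i \<in> I \<Longrightarrow> \<phi> i = (\<Sum>j\<in>J. \<phi> j * b j i)"
proof -
  note rb = assms[unfolded reduced_basis_def]
  show "J \<subseteq> I" using rb by (rule conjunct1)
  note rb1 = rb[THEN conjunct2, THEN conjunct1, rule_format]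
  show "b j \<in> W" if "j \<in> J" using rb1[OF that] by (rule conjunct1)
  show "b j i = of_bool (i = j)" if "j \<in> J" "i \<in> J" 
    using rb1[OF that(1), THEN conjunct2] that(2) by (rule bspec)
  show "\<phi> i = (\<Sum>j\<in>J. \<phi> j * b j i)" if "\<phi> \<in> W" "i \<in> I"
    using that by (rule rb[THEN conjunct2, THEN conjunct2, rule_format])
qed

lemma subspace_onD:
  assumes "subspace_on I W"
  shows "(\<lambda>_. 0) \<in> W"
    and "\<phi> \<in> W \<Longrightarrow> \<psi> \<in> W \<Longrightarrow> (\<lambda>i. \<phi> i + c * \<psi> i) \<in> W"
    and "\<phi> \<in> W \<Longrightarrow> (\<And>i. i \<in> I \<Longrightarrow> \<psi> i = \<phi> i) \<Longrightarrow> \<psi> \<in> W"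
  using assms unfolding subspace_on_def by blast+

lemma subspace_on_scale: "subspace_on I W \<Longrightarrow> \<phi> \<in> W \<Longrightarrow> (\<lambda>i. c * \<phi> i) \<in> W"
  using subspace_onD(2)[of I W "\<lambda>_. 0" \<phi> c, OF _ subspace_onD(1)[of I W]] by simp

lemma subspace_on_sum:
  assumes "subspace_on I W" "finite J" "\<And>j. j \<in> J \<Longrightarrow> b j \<in> W"
  shows "(\<lambda>i. \<Sum>j\<in>J. c j * b j i) \<in> W"
  using assms(2,3)
proof (induction J)
  case empty
  show ?case using subspace_onD(1)[OF assms(1)] by simp
next
  case (insert x F)
  have "(\<lambda>i. (\<Sum>j\<in>F. c j * b j i) + c x * b x i) \<in> W"
    using insert by (intro subspace_onD(2)[OF assms(1)]) auto
  then show ?case using insert.hyps by (simp add: add.commute)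
qed

text \<open>Gaussian elimination as a maximality argument: for \<open>J\<close> of greatest size, an
  element of \<open>W\<close> not spanned by the \<open>b j\<close> would leave a remainder that
  vanishes on \<open>J\<close> but not at some \<open>i\<close>, and \<open>i\<close> could be added
  to \<open>J\<close>.\<close>

lemma ex_reduced_basis:
  assumes I: "finite I" and W: "subspace_on I W"
  shows "\<exists>J b. reduced_basis I W J b"
proof -
  define P where "P J \<longleftrightarrow> J \<subseteq> I \<and> (\<exists>b. \<forall>j\<in>J. b j \<in> W \<and> (\<forall>i\<in>J. b j i = of_bool (i = j)))" for J
  have "P {}" by (simp add: P_def)
  moreover have bound: "\<forall>J. P J \<longrightarrow> card J \<le> card I" unfolding P_def using I card_mono by blast
  ultimately have "\<exists>J. P J \<and> (\<forall>K. P K \<longrightarrow> card K \<le> card J)"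
    by (intro ex_has_greatest_nat[of P "{}" card "Suc (card I)"]) (auto simp: less_Suc_eq_le)
  then obtain J where J: "P J" "\<And>K. P K \<Longrightarrow> card K \<le> card J" by blast
  then obtain b where JI: "J \<subseteq> I" and b: "\<And>j. j \<in> J \<Longrightarrow> b j \<in> W"
    "\<And>i j. j \<in> J \<Longrightarrow> i \<in> J \<Longrightarrow> b j i = of_bool (i = j)" unfolding P_def by blast
  have fJ: "finite J" using JI I finite_subset by blast
  have "\<phi> i = (\<Sum>j\<in>J. \<phi> j * b j i)" if \<phi>: "\<phi> \<in> W" and i: "i \<in> I" for \<phi> i
  proof (rule ccontr)
    define \<psi> where "\<psi> = (\<lambda>i. \<phi> i + (-1) * (\<Sum>j\<in>J. \<phi> j * b j i))"
    assume "\<not> ?thesis"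
    then have ne: "\<psi> i \<noteq> 0" unfolding \<psi>_def by simp
    have \<psi>W: "\<psi> \<in> W" unfolding \<psi>_def
      by (intro subspace_onD(2)[OF W] \<phi> subspace_on_sum[OF W fJ] b)
    have \<psi>J: "\<psi> k = 0" if "k \<in> J" for k
    proof -
      have "(\<Sum>j\<in>J. \<phi> j * b j k) = (\<Sum>j\<in>J. if j = k then \<phi> j else 0)"
        by (intro sum.cong) (auto simp: b that)
      then show ?thesis using that fJ by (simp add: \<psi>_def)
    qed
    then have iJ: "i \<notin> J" using ne by auto
    define d where "d = (\<lambda>l. (1 / \<psi> i) * \<psi> l)"
    have dW: "d \<in> W" unfolding d_def by (rule subspace_on_scale[OF W \<psi>W])
    have di: "d i = 1" and dJ: "\<And>k. k \<in> J \<Longrightarrow> d k = 0" using ne \<psi>J by (auto simp: d_def)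
    \<comment> \<open>The normalised remainder \<open>d\<close> clears coordinate \<open>i\<close>
      of the old \<open>b j\<close>; being zero on \<open>J\<close>, it leaves their other
      coordinates there alone.\<close>
    define b' where "b' j = (if j = i then d else (\<lambda>l. b j l + (- b j i) * d l))" for j
    have "b' j \<in> W" if "j \<in> insert i J" for j
      using that dW subspace_onD(2)[OF W b(1) dW, of j "- b j i"] unfolding b'_def by auto
    moreover have "b' j k = of_bool (k = j)" if "j \<in> insert i J" "k \<in> insert i J" for j k
      using that iJ b di dJ unfolding b'_def by auto
    ultimately have "P (insert i J)" unfolding P_def using JI i by blast
    from J(2)[OF this] show False using fJ iJ by simp
  qed
  with JI b show ?thesis unfolding reduced_basis_def
    by (intro exI[of _ J] exI[of _ b] conjI ballI) assumption+
qed

text \<open>The products \<open>A j i * b j i\<close> with \<open>j\<close> in \<open>J\<close> and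
  \<open>i\<close> outside occur once with each sign. When \<open>A\<close> preserves
  \<open>W\<close>, the first sum is the trace on \<open>W\<close> and the second the trace on the
  quotient.\<close>

lemma trace_split:
  assumes I: "finite I" and rb: "reduced_basis I W J b"
  shows "(\<Sum>i\<in>I. A i i) = (\<Sum>j\<in>J. apply_on I A (b j) j) + (\<Sum>i\<in>I - J. A i i - (\<Sum>j\<in>J. A j i * b j i))"
proof -
  have JI: "J \<subseteq> I" and fJ: "finite J" using reduced_basisD(1)[OF rb] I finite_subset by auto
  have "apply_on I A (b j) j = A j j + (\<Sum>l\<in>I - J. A j l * b j l)" if "j \<in> J" for j
  proof -
    have "(\<Sum>l\<in>J. A j l * b j l) = (\<Sum>l\<in>J. if l = j then A j l else 0)"
      using reduced_basisD(3)[OF rb] that by (intro sum.cong) auto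
    then show ?thesis unfolding apply_on_def
      using sum.subset_diff[OF JI I, of "\<lambda>l. A j l * b j l"] fJ that by simp
  qed
  then have "(\<Sum>j\<in>J. apply_on I A (b j) j) = (\<Sum>j\<in>J. A j j) + (\<Sum>i\<in>I - J. \<Sum>j\<in>J. A j i * b j i)"
    by (simp add: sum.distrib) (rule sum.swap)
  then show ?thesis
    using sum.subset_diff[OF JI I, of "\<lambda>i. A i i"] by (simp add: sum_subtractf)
qed

lemma apply_on_reduced_basis:
  assumes "reduced_basis I W J b" "apply_on I A \<phi> \<in> W" "i \<in> I"
  shows "apply_on I A \<phi> i = (\<Sum>j\<in>J. apply_on I A \<phi> j * b j i)"
  by (rule reduced_basisD(4)[OF assms])

text \<open>The coordinates of an element of \<open>W\<close> in the basis \<open>b\<close> are its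
  values on \<open>J\<close>, so evaluation at \<open>i\<close> is a matrix entry.\<close>

definition sub_kernel where
  "sub_kernel I b a g i j = apply_on I (a g) (b j) i"

text \<open>Modulo \<open>W\<close>, the coordinate vector at \<open>j\<close> in \<open>J\<close>
  is minus the combination, with coefficients \<open>b j i\<close>, of those at \<open>i\<close>
  outside \<open>J\<close>; the subtracted sum is this substitution.\<close>

definition quot_kernel where
  "quot_kernel J b a g i k = a g i k - (\<Sum>j\<in>J. a g j k * b j i)"

lemma apply_on_mult:
  assumes "kernel_rep \<G> I a" "g \<in> carrier \<G>" "h \<in> carrier \<G>" "i \<in> I"
  shows "apply_on I (a (g \<otimes>\<^bsub>\<G>\<^esub> h)) \<phi> i = apply_on I (a g) (apply_on I (a h) \<phi>) i"
proof -
  have "apply_on I (a (g \<otimes>\<^bsub>\<G>\<^esub> h)) \<phi> i = (\<Sum>l\<in>I. \<Sum>m\<in>I. a g i m * a h m l * \<phi> l)"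
    using assms unfolding kernel_rep_def apply_on_def by (auto simp: sum_distrib_right intro!: sum.cong)
  also have "\<dots> = apply_on I (a g) (apply_on I (a h) \<phi>) i"
    unfolding apply_on_def by (subst sum.swap) (simp add: sum_distrib_left mult.assoc)
  finally show ?thesis .
qed

lemma apply_on_one:
  assumes "kernel_rep \<G> I a" "i \<in> I"
  shows "apply_on I (a \<one>\<^bsub>\<G>\<^esub>) \<phi> i = \<phi> i"
proof -
  have "apply_on I (a \<one>\<^bsub>\<G>\<^esub>) \<phi> i = (\<Sum>l\<in>I. if l = i then \<phi> l else 0)"
    using assms unfolding kernel_rep_def apply_on_def by (intro sum.cong) auto
  then show ?thesis using assms unfolding kernel_rep_def by simp
qed

lemma kernel_rep_sub:
  assumes a: "kernel_rep \<G> I a" and rb: "reduced_basis I W J b"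
    and inv: "\<And>g \<phi>. g \<in> carrier \<G> \<Longrightarrow> \<phi> \<in> W \<Longrightarrow> apply_on I (a g) \<phi> \<in> W"
  shows "kernel_rep \<G> J (sub_kernel I b a)"
proof -
  have JI: "J \<subseteq> I" and fJ: "finite J" 
    using reduced_basisD(1)[OF rb] a finite_subset unfolding kernel_rep_def by auto
  note bW = reduced_basisD(2)[OF rb]
  have "sub_kernel I b a (g \<otimes>\<^bsub>\<G>\<^esub> h) i j = (\<Sum>l\<in>J. sub_kernel I b a g i l * sub_kernel I b a h l j)"
    if g: "g \<in> carrier \<G>" "h \<in> carrier \<G>" and ij: "i \<in> J" "j \<in> J" for g h i j
  proof -
    have iI: "i \<in> I" using JI ij by auto
    have "apply_on I (a (g \<otimes>\<^bsub>\<G>\<^esub> h)) (b j) i = (\<Sum>m\<in>I. a g i m * apply_on I (a h) (b j) m)"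
      unfolding apply_on_mult[OF a g iI] by (simp add: apply_on_def)
    also have "\<dots> = (\<Sum>m\<in>I. a g i m * (\<Sum>l\<in>J. apply_on I (a h) (b j) l * b l m))"
      using apply_on_reduced_basis[OF rb inv[OF g(2) bW[OF ij(2)]]] by (intro sum.cong) auto
    also have "\<dots> = (\<Sum>m\<in>I. \<Sum>l\<in>J. a g i m * b l m * apply_on I (a h) (b j) l)"
      by (simp add: sum_distrib_left mult_ac)
    also have "\<dots> = (\<Sum>l\<in>J. apply_on I (a g) (b l) i * apply_on I (a h) (b j) l)"
      unfolding apply_on_def[of I "a g"] by (subst sum.swap) (simp add: sum_distrib_right)
    finally show ?thesis by (simp add: sub_kernel_def)
  qed
  moreover have "sub_kernel I b a \<one>\<^bsub>\<G>\<^esub> i j = of_bool (i = j)" if "i \<in> J" "j \<in> J" for i j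
    using apply_on_one[OF a, of i] reduced_basisD(3)[OF rb] that JI unfolding sub_kernel_def by auto
  ultimately show ?thesis using fJ unfolding kernel_rep_def by blast
qed

lemma kernel_rep_quot:
  assumes a: "kernel_rep \<G> I a" and rb: "reduced_basis I W J b"
    and inv: "\<And>g \<phi>. g \<in> carrier \<G> \<Longrightarrow> \<phi> \<in> W \<Longrightarrow> apply_on I (a g) \<phi> \<in> W"
  shows "kernel_rep \<G> (I - J) (quot_kernel J b a)"
proof -
  have JI: "J \<subseteq> I" and fI: "finite I" and fJ: "finite J" 
    using reduced_basisD(1)[OF rb] a finite_subset unfolding kernel_rep_def by auto
  note bW = reduced_basisD(2)[OF rb]
  let ?q = "quot_kernel J b a"
  have "?q (g \<otimes>\<^bsub>\<G>\<^esub> h) i k = (\<Sum>m\<in>I - J. ?q g i m * ?q h m k)"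
    if g: "g \<in> carrier \<G>" "h \<in> carrier \<G>" and ik: "i \<in> I - J" "k \<in> I - J" for g h i k
  proof -
    \<comment> \<open>A row of \<open>?q g\<close> annihilates \<open>W\<close>: by invariance the
      image of \<open>b j\<close> lies in \<open>W\<close>, where the values on \<open>J\<close>
      determine all others.\<close>
    have kill: "(\<Sum>m\<in>I. ?q g i m * b j m) = 0" if j: "j \<in> J" for j
    proof -
      have "(\<Sum>m\<in>I. ?q g i m * b j m) =
          apply_on I (a g) (b j) i - (\<Sum>m\<in>I. \<Sum>l\<in>J. a g l m * b j m * b l i)"
        unfolding quot_kernel_def apply_on_def left_diff_distrib sum_subtractf sum_distrib_right
        by (simp add: mult_ac)
      also have "(\<Sum>m\<in>I. \<Sum>l\<in>J. a g l m * b j m * b l i) = (\<Sum>l\<in>J. apply_on I (a g) (b j) l * b l i)"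
        unfolding apply_on_def by (subst sum.swap) (simp add: sum_distrib_right)
      finally show ?thesis
        using apply_on_reduced_basis[OF rb inv[OF g(1) bW[OF j]]] ik by simp
    qed
    \<comment> \<open>The corrections in \<open>?q h\<close> thereby turn into the missing columns
      of \<open>?q g\<close>, and the sum over \<open>I - J\<close> becomes one over all of
      \<open>I\<close>.\<close>
    have split: "(\<Sum>m\<in>I - J. ?q g i m * b j m) = - ?q g i j" if j: "j \<in> J" for j
    proof -
      have "(\<Sum>m\<in>J. ?q g i m * b j m) = (\<Sum>m\<in>J. if m = j then ?q g i m else 0)"
        using reduced_basisD(3)[OF rb j] by (intro sum.cong) auto
      also have "\<dots> = ?q g i j" using j fJ by simp
      finally have "(\<Sum>m\<in>I - J. ?q g i m * b j m) + ?q g i j = 0"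
        using kill[OF j] unfolding sum.subset_diff[OF JI fI, of "\<lambda>m. ?q g i m * b j m"]
        by (simp only:)
      then show ?thesis by (simp only: eq_neg_iff_add_eq_0)
    qed
    have "(\<Sum>m\<in>I - J. ?q g i m * ?q h m k) = (\<Sum>m\<in>I - J. ?q g i m * a h m k)
        - (\<Sum>m\<in>I - J. \<Sum>j\<in>J. a h j k * (?q g i m * b j m))"
      unfolding quot_kernel_def[of J b a h] right_diff_distrib sum_subtractf sum_distrib_left
      by (simp add: mult_ac)
    also have "(\<Sum>m\<in>I - J. \<Sum>j\<in>J. a h j k * (?q g i m * b j m)) = (\<Sum>j\<in>J. a h j k * - ?q g i j)"
      by (subst sum.swap) (simp only: sum_distrib_left[symmetric] split cong: sum.cong)
    also have "(\<Sum>m\<in>I - J. ?q g i m * a h m k) - (\<Sum>j\<in>J. a h j k * - ?q g i j)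
        = (\<Sum>m\<in>I. ?q g i m * a h m k)"
      unfolding sum.subset_diff[OF JI fI, of "\<lambda>m. ?q g i m * a h m k"]
      by (simp add: sum_negf mult.commute)
    also have "\<dots> = (\<Sum>m\<in>I. a g i m * a h m k) - (\<Sum>m\<in>I. \<Sum>j\<in>J. a g j m * a h m k * b j i)"
      unfolding quot_kernel_def left_diff_distrib sum_subtractf sum_distrib_right
      by (simp add: mult_ac)
    also have "(\<Sum>m\<in>I. \<Sum>j\<in>J. a g j m * a h m k * b j i) = (\<Sum>j\<in>J. (\<Sum>m\<in>I. a g j m * a h m k) * b j i)"
      by (subst sum.swap) (simp add: sum_distrib_right)
    also have "(\<Sum>m\<in>I. a g i m * a h m k) - \<dots> = ?q (g \<otimes>\<^bsub>\<G>\<^esub> h) i k"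
    proof -
      have "a (g \<otimes>\<^bsub>\<G>\<^esub> h) l k = (\<Sum>m\<in>I. a g l m * a h m k)" if "l \<in> I" for l
        using a g ik that unfolding kernel_rep_def by blast
      then show ?thesis using ik JI unfolding quot_kernel_def by (simp add: subset_iff)
    qed
    finally show ?thesis by simp
  qed
  moreover have "?q \<one>\<^bsub>\<G>\<^esub> i k = of_bool (i = k)" if "i \<in> I - J" "k \<in> I - J" for i k
  proof -
    have "(\<Sum>j\<in>J. a \<one>\<^bsub>\<G>\<^esub> j k * b j i) = 0"
      using a that JI unfolding kernel_rep_def by (intro sum.neutral) auto
    then show ?thesis using a that unfolding quot_kernel_def kernel_rep_def by auto
  qed
  ultimately show ?thesis using fI unfolding kernel_rep_def by blast
qed

text \<open>The image of a projection is its fixed space \<open>W\<close>. Each basis element of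
  \<open>W\<close> contributes 1 to the trace, and the quotient contributes nothing because the
  columns of \<open>p\<close> lie in \<open>W\<close>; the trace is the dimension
  \<open>card J\<close>.\<close>

lemma trace_idempotent:
  fixes p :: "'i \<Rightarrow> 'i \<Rightarrow> complex"
  assumes I: "finite I"
    and idem: "\<And>i j. i \<in> I \<Longrightarrow> j \<in> I \<Longrightarrow> (\<Sum>l\<in>I. p i l * p l j) = p i j"
  shows "\<exists>n :: nat. (\<Sum>i\<in>I. p i i) = of_nat n"
proof -
  define W where "W = {\<phi>. \<forall>i\<in>I. apply_on I p \<phi> i = \<phi> i}"
  have lin: "apply_on I p (\<lambda>i. \<phi> i + c * \<psi> i) i = apply_on I p \<phi> i + c * apply_on I p \<psi> i" for \<phi> \<psi> c i
    unfolding apply_on_def by (simp add: distrib_left sum.distrib sum_distrib_left mult.left_commute)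
  have "(\<lambda>i. \<phi> i + c * \<psi> i) \<in> W" if "\<phi> \<in> W" "\<psi> \<in> W" for \<phi> \<psi> c
    using that unfolding W_def mem_Collect_eq lin by simp
  moreover have "\<psi> \<in> W" if "\<phi> \<in> W" "\<forall>i\<in>I. \<psi> i = \<phi> i" for \<phi> \<psi>
    using that by (simp add: W_def apply_on_def)
  moreover have "(\<lambda>_. 0) \<in> W" by (simp add: W_def apply_on_def)
  ultimately have "subspace_on I W" unfolding subspace_on_def by blast
  then obtain J b where rb: "reduced_basis I W J b" using ex_reduced_basis[OF I] by blast
  have "apply_on I p (b j) j = 1" if "j \<in> J" for j
    using reduced_basisD(1-3)[OF rb] that unfolding W_def by auto
  moreover have "p i i - (\<Sum>j\<in>J. p j i * b j i) = 0" if i: "i \<in> I - J" for i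
  proof -
    have "(\<lambda>l. p l i) \<in> W" using idem i by (auto simp: W_def apply_on_def)
    from reduced_basisD(4)[OF rb this, of i] show ?thesis using i by simp
  qed
  ultimately show ?thesis unfolding trace_split[OF I rb] by (intro exI[of _ "card J"]) simp
qed

section \<open>Effective characters\<close>

lemma effective_character_cong:
  assumes "effective_character \<G> \<phi>" "\<And>g. g \<in> carrier \<G> \<Longrightarrow> \<psi> g = \<phi> g"
  shows "effective_character \<G> \<psi>"
  using assms unfolding effective_character_def by auto

lemma effective_character_zero: "effective_character \<G> (\<lambda>_. 0)"
  unfolding effective_character_def by (rule exI[of _ "{}"]) simp

lemma effective_character_add:
  assumes "effective_character \<G> \<phi>" "effective_character \<G> \<psi>"
  shows "effective_character \<G> (\<lambda>g. \<phi> g + \<psi> g)"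
proof -
  obtain S m where S: "finite S" "S \<subseteq> irreducible_characters \<G>"
    "\<And>g. g \<in> carrier \<G> \<Longrightarrow> \<phi> g = (\<Sum>\<eta>\<in>S. of_nat (m \<eta>) * \<eta> g)"
    using assms(1) unfolding effective_character_def by blast
  obtain T n where T: "finite T" "T \<subseteq> irreducible_characters \<G>"
    "\<And>g. g \<in> carrier \<G> \<Longrightarrow> \<psi> g = (\<Sum>\<eta>\<in>T. of_nat (n \<eta>) * \<eta> g)"
    using assms(2) unfolding effective_character_def by blast
  define k where "k \<eta> = (if \<eta> \<in> S then m \<eta> else 0) + (if \<eta> \<in> T then n \<eta> else 0)" for \<eta>
  have "\<phi> g + \<psi> g = (\<Sum>\<eta>\<in>S \<union> T. of_nat (k \<eta>) * \<eta> g)" if g: "g \<in> carrier \<G>" for g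
  proof -
    have "(\<Sum>\<eta>\<in>S \<union> T. of_nat (k \<eta>) * \<eta> g) =
        (\<Sum>\<eta>\<in>S \<union> T. if \<eta> \<in> S then of_nat (m \<eta>) * \<eta> g else 0)
        + (\<Sum>\<eta>\<in>S \<union> T. if \<eta> \<in> T then of_nat (n \<eta>) * \<eta> g else 0)"
      unfolding sum.distrib[symmetric] by (intro sum.cong) (auto simp: k_def distrib_right)
    also have "(\<Sum>\<eta>\<in>S \<union> T. if \<eta> \<in> S then of_nat (m \<eta>) * \<eta> g else 0) = \<phi> g"
      unfolding S(3)[OF g] using S(1) T(1) by (intro sum.mono_neutral_cong_right) auto
    also have "(\<Sum>\<eta>\<in>S \<union> T. if \<eta> \<in> T then of_nat (n \<eta>) * \<eta> g else 0) = \<psi> g"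
      unfolding T(3)[OF g] using S(1) T(1) by (intro sum.mono_neutral_cong_right) auto
    finally show ?thesis by simp
  qed
  then show ?thesis unfolding effective_character_def using S(1,2) T(1,2)
    by (intro exI[of _ "S \<union> T"] exI[of _ k]) auto
qed

lemma effective_character_irreducible:
  assumes "\<eta> \<in> irreducible_characters \<G>"
  shows "effective_character \<G> \<eta>"
  unfolding effective_character_def using assms
  by (intro exI[of _ "{\<eta>}"] exI[of _ "\<lambda>_. 1"]) simp

section \<open>Kernels on index sets versus matrix representations\<close>

lemma mult_mat_index:
  assumes "A \<in> carrier_mat n n" "B \<in> carrier_mat n n" "i < n" "j < n"
  shows "(A * B) $$ (i, j) = (\<Sum>l<n. A $$ (i, l) * B $$ (l, j))"
  using assms by (auto simp: scalar_prod_def lessThan_atLeast0 intro!: sum.cong)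

lemma representation_of_kernel_rep:
  assumes G: "group \<G>" and a: "kernel_rep \<G> {..<n} a"
  shows "representation \<G> n (\<lambda>g. mat n n (\<lambda>(i, j). a g i j))"
proof -
  define \<rho> where "\<rho> g = mat n n (\<lambda>(i, j). a g i j)" for g
  have carr: "\<rho> g \<in> carrier_mat n n" for g by (simp add: \<rho>_def)
  have mult: "\<rho> (g \<otimes>\<^bsub>\<G>\<^esub> h) = \<rho> g * \<rho> h" if "g \<in> carrier \<G>" "h \<in> carrier \<G>" for g h
  proof (rule eq_matI)
    fix i j assume "i < dim_row (\<rho> g * \<rho> h)" "j < dim_col (\<rho> g * \<rho> h)"
    then have ij: "i < n" "j < n" by (simp_all add: \<rho>_def)
    have "a (g \<otimes>\<^bsub>\<G>\<^esub> h) i j = (\<Sum>l<n. a g i l * a h l j)"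
      using a that ij unfolding kernel_rep_def by blast
    then show "\<rho> (g \<otimes>\<^bsub>\<G>\<^esub> h) $$ (i, j) = (\<rho> g * \<rho> h) $$ (i, j)"
      unfolding mult_mat_index[OF carr carr ij] using ij by (simp add: \<rho>_def)
  qed (simp_all add: \<rho>_def)
  have one: "\<rho> \<one>\<^bsub>\<G>\<^esub> = 1\<^sub>m n"
    using a unfolding kernel_rep_def by (intro eq_matI) (auto simp: \<rho>_def)
  have "\<rho> g \<in> Units (ring_mat TYPE(complex) n ())" if g: "g \<in> carrier \<G>" for g
  proof -
    have "\<rho> (inv\<^bsub>\<G>\<^esub> g) * \<rho> g = 1\<^sub>m n" "\<rho> g * \<rho> (inv\<^bsub>\<G>\<^esub> g) = 1\<^sub>m n"
      using mult[of "inv\<^bsub>\<G>\<^esub> g" g] mult[of g "inv\<^bsub>\<G>\<^esub> g"] g G one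
      by (simp_all add: group.l_inv group.r_inv)
    then show ?thesis unfolding Units_def ring_mat_simps using carr by blast
  qed
  then show ?thesis unfolding representation_def GL_def hom_def \<rho>_def[symmetric]
    using mult by (auto simp: units_of_def ring_mat_simps)
qed

lemma kernel_rep_of_representation:
  assumes G: "group \<G>" and \<rho>: "representation \<G> n \<rho>"
  shows "kernel_rep \<G> {..<n} (\<lambda>g i j. \<rho> g $$ (i, j))"
    and "\<And>g. g \<in> carrier \<G> \<Longrightarrow> mat_trace (\<rho> g) = (\<Sum>i<n. \<rho> g $$ (i, i))"
proof -
  have U: "\<rho> g \<in> Units (ring_mat TYPE(complex) n ())" if "g \<in> carrier \<G>" for g
    using \<rho> that unfolding representation_def GL_def hom_def by (auto simp: units_of_def)
  then have carr: "\<rho> g \<in> carrier_mat n n" if "g \<in> carrier \<G>" for g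
    using that unfolding Units_def ring_mat_simps by blast
  have mult: "\<rho> (g \<otimes>\<^bsub>\<G>\<^esub> h) = \<rho> g * \<rho> h" if "g \<in> carrier \<G>" "h \<in> carrier \<G>" for g h
    using \<rho> that unfolding representation_def GL_def hom_def
    by (auto simp: units_of_def ring_mat_simps)
  have oneG: "\<one>\<^bsub>\<G>\<^esub> \<in> carrier \<G>" using G by (simp add: group.is_monoid monoid.one_closed)
  \<comment> \<open>\<open>hom\<close> only records products, so the image of the neutral element is
    so far just idempotent; being invertible, it is the identity matrix.\<close>
  have "\<rho> \<one>\<^bsub>\<G>\<^esub> * \<rho> \<one>\<^bsub>\<G>\<^esub> = \<rho> \<one>\<^bsub>\<G>\<^esub>"
    using mult[OF oneG oneG] G oneG by (simp add: group.is_monoid monoid.l_one)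
  moreover obtain B where B: "B \<in> carrier_mat n n" "B * \<rho> \<one>\<^bsub>\<G>\<^esub> = 1\<^sub>m n"
    using U[OF oneG] unfolding Units_def ring_mat_simps by blast
  ultimately have "\<rho> \<one>\<^bsub>\<G>\<^esub> = 1\<^sub>m n"
    using assoc_mult_mat[OF B(1) carr[OF oneG] carr[OF oneG]] carr[OF oneG] by simp
  moreover have "\<rho> (g \<otimes>\<^bsub>\<G>\<^esub> h) $$ (i, j) = (\<Sum>l<n. \<rho> g $$ (i, l) * \<rho> h $$ (l, j))"
    if "g \<in> carrier \<G>" "h \<in> carrier \<G>" "i < n" "j < n" for g h i j
    unfolding mult[OF that(1,2)] by (rule mult_mat_index[OF carr carr]) (use that in auto)
  ultimately show "kernel_rep \<G> {..<n} (\<lambda>g i j. \<rho> g $$ (i, j))"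
    unfolding kernel_rep_def by auto
  show "mat_trace (\<rho> g) = (\<Sum>i<n. \<rho> g $$ (i, i))" if "g \<in> carrier \<G>" for g
    using carr[OF that] by (simp add: mat_trace_def)
qed

definition irreducible_kernel :: "('g, 'm) monoid_scheme \<Rightarrow> 'i set \<Rightarrow> ('g \<Rightarrow> 'i \<Rightarrow> 'i \<Rightarrow> complex) \<Rightarrow> bool"
  where "irreducible_kernel \<G> I a \<longleftrightarrow> I \<noteq> {} \<and>
     (\<forall>W. subspace_on I W \<and> (\<forall>g\<in>carrier \<G>. \<forall>\<phi>\<in>W. apply_on I (a g) \<phi> \<in> W) \<longrightarrow>
       (\<forall>\<phi>\<in>W. \<forall>i\<in>I. \<phi> i = 0) \<or> W = UNIV)"

text \<open>Matrices are indexed by numbers, so here the index set gets enumerated. An invariant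
  subspace of vectors is pulled back along the enumeration \<open>e\<close> to functions on
  \<open>I\<close>, where irreducibility of the kernel applies.\<close>

lemma irreducible_character_of_kernel:
  assumes G: "group \<G>" and a: "kernel_rep \<G> I a" and irr: "irreducible_kernel \<G> I a"
  shows "restrict (\<lambda>g. \<Sum>i\<in>I. a g i i) (carrier \<G>) \<in> irreducible_characters \<G>"
proof -
  have fI: "finite I" using a by (simp add: kernel_rep_def)
  define n where "n = card I"
  obtain e where e: "bij_betw e {..<n} I"
    using ex_bij_betw_nat_finite[OF fI] unfolding n_def lessThan_atLeast0 by blast
  have eI: "e i \<in> I" if "i < n" for i using e that by (auto simp: bij_betw_def)
  have e_eq: "e i = e j \<longleftrightarrow> i = j" if "i < n" "j < n" for i j
    using e that by (auto simp: bij_betw_def inj_on_def)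
  have sum_e: "(\<Sum>l\<in>I. f l) = (\<Sum>l<n. f (e l))" for f :: "_ \<Rightarrow> complex"
    using sum.reindex_bij_betw[OF e] by metis
  define d where "d = inv_into {..<n} e"
  have d: "d (e i) = i" if "i < n" for i using e that by (auto simp: d_def bij_betw_def)
  have de: "d l < n" "e (d l) = l" if "l \<in> I" for l
    using e that by (auto simp: d_def bij_betw_def inv_into_into f_inv_into_f)
  define \<rho> where "\<rho> g = mat n n (\<lambda>(i, j). a g (e i) (e j))" for g
  have "kernel_rep \<G> {..<n} (\<lambda>g i j. a g (e i) (e j))"
    using a unfolding kernel_rep_def by (auto simp: eI e_eq sum_e)
  then have rep: "representation \<G> n \<rho>"
    unfolding \<rho>_def by (rule representation_of_kernel_rep[OF G])
  have act: "\<rho> g *\<^sub>v vec n (\<lambda>i. \<phi> (e i)) = vec n (\<lambda>i. apply_on I (a g) \<phi> (e i))" for g \<phi>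
    by (intro eq_vecI)
      (auto simp: \<rho>_def apply_on_def scalar_prod_def sum_e lessThan_atLeast0 intro!: sum.cong)
  have "W = {0\<^sub>v n} \<or> W = carrier_vec n"
    if W: "VectorSpace.subspace class_ring W (module_vec TYPE(complex) n)"
      and inv: "\<And>g w. g \<in> carrier \<G> \<Longrightarrow> w \<in> W \<Longrightarrow> \<rho> g *\<^sub>v w \<in> W" for W
  proof -
    have sm: "submodule class_ring W (module_vec TYPE(complex) n)"
      using W by (simp add: VectorSpace.subspace_def)
    have Wsub: "W \<subseteq> carrier_vec n" and W0: "0\<^sub>v n \<in> W"
      and Wadd: "\<And>v w. v \<in> W \<Longrightarrow> w \<in> W \<Longrightarrow> v + w \<in> W"
      and Wsm: "\<And>c w. w \<in> W \<Longrightarrow> c \<cdot>\<^sub>v w \<in> W"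
      using submodule.subset[OF sm] submodule.zero_closed[OF sm] submodule.m_closed[OF sm]
        submodule.smult_closed[OF sm] by (auto simp: module_vec_simps)
    define W' where "W' = {\<phi>. vec n (\<lambda>i. \<phi> (e i)) \<in> W}"
    have toW: "vec n (\<lambda>i. w $ d (e i)) = w" if "w \<in> W" for w
      using Wsub that by (intro eq_vecI) (auto simp: d)
    have "(\<lambda>i. \<phi> i + c * \<psi> i) \<in> W'" if "\<phi> \<in> W'" "\<psi> \<in> W'" for \<phi> \<psi> c
    proof -
      have "vec n (\<lambda>i. \<phi> (e i) + c * \<psi> (e i)) = vec n (\<lambda>i. \<phi> (e i)) + c \<cdot>\<^sub>v vec n (\<lambda>i. \<psi> (e i))"
        by (intro eq_vecI) auto
      then show ?thesis using that Wadd Wsm by (simp add: W'_def)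
    qed
    moreover have "(\<lambda>_. 0) \<in> W'"
    proof -
      have "vec n (\<lambda>i. 0) = (0\<^sub>v n :: complex vec)" by (intro eq_vecI) auto
      then show ?thesis using W0 by (simp add: W'_def)
    qed
    moreover have "\<psi> \<in> W'" if "\<phi> \<in> W'" "\<forall>i\<in>I. \<psi> i = \<phi> i" for \<phi> \<psi>
    proof -
      have "vec n (\<lambda>i. \<psi> (e i)) = vec n (\<lambda>i. \<phi> (e i))" using that eI by (intro eq_vecI) auto
      then show ?thesis using that by (simp add: W'_def)
    qed
    ultimately have "subspace_on I W'" unfolding subspace_on_def by blast
    moreover have "apply_on I (a g) \<phi> \<in> W'" if "g \<in> carrier \<G>" "\<phi> \<in> W'" for g \<phi>
      using inv[OF that(1), of "vec n (\<lambda>i. \<phi> (e i))"] that(2) unfolding act W'_def by simp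
    ultimately consider "\<forall>\<phi>\<in>W'. \<forall>i\<in>I. \<phi> i = 0" | "W' = UNIV"
      using irr unfolding irreducible_kernel_def by blast
    then show ?thesis
    proof cases
      case 1
      have "w = 0\<^sub>v n" if w: "w \<in> W" for w
      proof (rule eq_vecI)
        have "(\<lambda>l. w $ d l) \<in> W'" using toW[OF w] w by (simp add: W'_def)
        from 1[rule_format, OF this] have "w $ d (e i) = 0" if "i < n" for i using eI[OF that] .
        then show "w $ i = 0\<^sub>v n $ i" if "i < dim_vec (0\<^sub>v n :: complex vec)" for i using that by (simp add: d)
        show "dim_vec w = dim_vec (0\<^sub>v n :: complex vec)" using Wsub w by auto
      qed
      then show ?thesis using W0 by blast
    next
      case 2
      have "w \<in> W" if w: "w \<in> carrier_vec n" for w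
      proof -
        have "(\<lambda>l. w $ d l) \<in> W'" using 2 by simp
        moreover have "vec n (\<lambda>i. w $ d (e i)) = w" using w by (intro eq_vecI) (auto simp: d)
        ultimately show ?thesis by (simp add: W'_def)
      qed
      then show ?thesis using Wsub by blast
    qed
  qed
  moreover have "n > 0" using irr fI unfolding irreducible_kernel_def n_def by auto
  ultimately have "irreducible_representation \<G> n \<rho>"
    unfolding irreducible_representation_def using rep by blast
  moreover have "(\<Sum>i\<in>I. a g i i) = mat_trace (\<rho> g)" for g
    by (simp add: mat_trace_def \<rho>_def sum_e)
  ultimately show ?thesis unfolding irreducible_characters_def by auto
qed

text \<open>A composition series suffices: the trace adds up over subrepresentation and quotient, so complete
  reducibility is not needed.\<close>

theorem effective_character_trace:
  assumes G: "group \<G>" and a: "kernel_rep \<G> I a"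
  shows "effective_character \<G> (\<lambda>g. \<Sum>i\<in>I. a g i i)"
  using a
proof (induction "card I" arbitrary: I a rule: less_induct)
  case less
  note a = less.prems
  have fI: "finite I" using a by (simp add: kernel_rep_def)
  consider "I = {}" | "irreducible_kernel \<G> I a" | "I \<noteq> {}" "\<not> irreducible_kernel \<G> I a" by blast
  then show ?case
  proof cases
    case 1
    then show ?thesis by (simp add: effective_character_zero)
  next
    case 2
    show ?thesis
      by (rule effective_character_cong[OF effective_character_irreducible[OF
            irreducible_character_of_kernel[OF G a 2]]]) simp
  next
    case 3
    then obtain W where W: "subspace_on I W"
      and inv: "\<And>g \<phi>. g \<in> carrier \<G> \<Longrightarrow> \<phi> \<in> W \<Longrightarrow> apply_on I (a g) \<phi> \<in> W"
      and nz: "\<exists>\<phi>\<in>W. \<exists>i\<in>I. \<phi> i \<noteq> 0" and nU: "W \<noteq> UNIV"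
      unfolding irreducible_kernel_def by blast
    obtain J b where rb: "reduced_basis I W J b" using ex_reduced_basis[OF fI W] by blast
    have JI: "J \<subseteq> I" and bW: "\<And>j. j \<in> J \<Longrightarrow> b j \<in> W" using reduced_basisD[OF rb] by auto
    \<comment> \<open>Since \<open>W\<close> is neither zero nor everything on \<open>I\<close>,
      both \<open>J\<close> and \<open>I - J\<close> are smaller than \<open>I\<close>, as the
      induction requires.\<close>
    have "J \<noteq> {}"
    proof
      assume "J = {}"
      then have "\<phi> i = 0" if "\<phi> \<in> W" "i \<in> I" for \<phi> i
        using reduced_basisD(4)[OF rb that] by (simp only: sum.empty)
      then show False using nz by blast
    qed
    have "J \<noteq> I"
    proof
      assume JI: "J = I"
      have "\<phi> \<in> W" for \<phi>
      proof (rule subspace_onD(3)[OF W subspace_on_sum[OF W fI bW[unfolded JI], where c = \<phi>]])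
        fix i assume i: "i \<in> I"
        have "(\<Sum>j\<in>I. \<phi> j * b j i) = (\<Sum>j\<in>I. if j = i then \<phi> j else 0)"
          using reduced_basisD(3)[OF rb] i JI by (intro sum.cong) auto
        then show "\<phi> i = (\<Sum>j\<in>I. \<phi> j * b j i)" using fI i by simp
      qed
      then show False using nU by blast
    qed
    have "card J < card I" using JI \<open>J \<noteq> I\<close> fI by (simp add: psubset_card_mono psubsetI)
    from less.hyps[OF this kernel_rep_sub[OF a rb inv]]
    have 1: "effective_character \<G> (\<lambda>g. \<Sum>i\<in>J. sub_kernel I b a g i i)" .
    have "card (I - J) < card I" using JI \<open>J \<noteq> {}\<close> fI by (intro psubset_card_mono) auto
    from less.hyps[OF this kernel_rep_quot[OF a rb inv]]
    have 2: "effective_character \<G> (\<lambda>g. \<Sum>i\<in>I - J. quot_kernel J b a g i i)" .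
    show ?thesis
      by (rule effective_character_cong[OF effective_character_add[OF 1 2]])
        (simp add: trace_split[OF fI rb] sub_kernel_def quot_kernel_def)
  qed
qed

section \<open>Inner products of characters\<close>

text \<open>Entrywise conjugation respects products, so the conjugate of \<open>a\<close> is again a
  representation, and tensoring with it turns the product of a conjugated character with another
  character into a single trace.\<close>

lemma kernel_rep_tensor:
  assumes a: "kernel_rep \<G> I a" and b: "kernel_rep \<G> J b"
  shows "kernel_rep \<G> (I \<times> J) (\<lambda>g p q. cnj (a g (fst p) (fst q)) * b g (snd p) (snd q))"
proof -
  have "cnj (a (g \<otimes>\<^bsub>\<G>\<^esub> h) i j) * b (g \<otimes>\<^bsub>\<G>\<^esub> h) i' j' =
      (\<Sum>(l, l')\<in>I \<times> J. cnj (a g i l) * b g i' l' * (cnj (a h l j) * b h l' j'))"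
    if "g \<in> carrier \<G>" "h \<in> carrier \<G>" "i \<in> I" "j \<in> I" "i' \<in> J" "j' \<in> J" for g h i j i' j'
  proof -
    have "a (g \<otimes>\<^bsub>\<G>\<^esub> h) i j = (\<Sum>l\<in>I. a g i l * a h l j)"
      "b (g \<otimes>\<^bsub>\<G>\<^esub> h) i' j' = (\<Sum>l\<in>J. b g i' l * b h l j')"
      using a b that unfolding kernel_rep_def by blast+
    then show ?thesis
      by (simp only: cnj_sum complex_cnj_mult sum_product sum.cartesian_product) (simp add: mult_ac)
  qed
  moreover have "cnj (a \<one>\<^bsub>\<G>\<^esub> i j) * b \<one>\<^bsub>\<G>\<^esub> i' j' = of_bool ((i, i') = (j, j'))"
    if "i \<in> I" "j \<in> I" "i' \<in> J" "j' \<in> J" for i j i' j'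
  proof -
    have "a \<one>\<^bsub>\<G>\<^esub> i j = of_bool (i = j)" "b \<one>\<^bsub>\<G>\<^esub> i' j' = of_bool (i' = j')"
      using a b that unfolding kernel_rep_def by blast+
    then show ?thesis by simp
  qed
  moreover have "finite (I \<times> J)" using a b unfolding kernel_rep_def by blast
  ultimately show ?thesis unfolding kernel_rep_def by (auto simp: split_def)
qed

text \<open>The averaged kernel is a projection.\<close>

lemma average_trace_nat:
  assumes G: "group \<G>" and fin: "finite (carrier \<G>)" and a: "kernel_rep \<G> I a"
  shows "\<exists>n :: nat. 1 / of_nat (card (carrier \<G>)) * (\<Sum>g\<in>carrier \<G>. \<Sum>i\<in>I. a g i i) = of_nat n"
proof -
  let ?N = "of_nat (card (carrier \<G>)) :: complex"
  have N: "?N \<noteq> 0" using fin G group.is_monoid monoid.one_closed by (fastforce simp: card_eq_0_iff)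
  define p where "p i j = 1 / ?N * (\<Sum>g\<in>carrier \<G>. a g i j)" for i j
  have "(\<Sum>l\<in>I. p i l * p l j) = p i j" if ij: "i \<in> I" "j \<in> I" for i j
  proof -
    \<comment> \<open>Left translation permutes the group, so the average absorbs every
      \<open>g\<close>; this is the source of idempotence.\<close>
    have shift: "(\<Sum>h\<in>carrier \<G>. a (g \<otimes>\<^bsub>\<G>\<^esub> h) i j) = (\<Sum>h\<in>carrier \<G>. a h i j)"
      if g: "g \<in> carrier \<G>" for g
    proof (rule sum.reindex_bij_betw)
      show "bij_betw (\<lambda>h. g \<otimes>\<^bsub>\<G>\<^esub> h) (carrier \<G>) (carrier \<G>)"
        using group.inj_on_cmult[OF G g] group.surj_const_mult[OF G g] by (simp add: bij_betw_def)
    qed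
    have "(\<Sum>l\<in>I. p i l * p l j) =
        1 / ?N * (1 / ?N) * (\<Sum>l\<in>I. \<Sum>g\<in>carrier \<G>. \<Sum>h\<in>carrier \<G>. a g i l * a h l j)"
      unfolding p_def by (simp add: sum_product sum_distrib_left mult_ac)
    also have "(\<Sum>l\<in>I. \<Sum>g\<in>carrier \<G>. \<Sum>h\<in>carrier \<G>. a g i l * a h l j) =
        (\<Sum>g\<in>carrier \<G>. \<Sum>h\<in>carrier \<G>. \<Sum>l\<in>I. a g i l * a h l j)"
      by (subst sum.swap, rule sum.cong[OF refl], rule sum.swap)
    also have "\<dots> = (\<Sum>g\<in>carrier \<G>. \<Sum>h\<in>carrier \<G>. a (g \<otimes>\<^bsub>\<G>\<^esub> h) i j)"
    proof (intro sum.cong refl)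
      fix g h assume "g \<in> carrier \<G>" "h \<in> carrier \<G>"
      then have "a (g \<otimes>\<^bsub>\<G>\<^esub> h) i j = (\<Sum>l\<in>I. a g i l * a h l j)"
        using a ij unfolding kernel_rep_def by blast
      then show "(\<Sum>l\<in>I. a g i l * a h l j) = a (g \<otimes>\<^bsub>\<G>\<^esub> h) i j" by (rule sym)
    qed
    also have "\<dots> = ?N * (\<Sum>h\<in>carrier \<G>. a h i j)" by (simp add: shift)
    finally show ?thesis using N by (simp add: p_def)
  qed
  moreover have "finite I" using a unfolding kernel_rep_def by blast
  ultimately obtain n where "(\<Sum>i\<in>I. p i i) = of_nat n" using trace_idempotent[of I p] by blast
  moreover have "(\<Sum>i\<in>I. p i i) = 1 / ?N * (\<Sum>g\<in>carrier \<G>. \<Sum>i\<in>I. a g i i)"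
    unfolding p_def sum_distrib_left[symmetric] by (subst sum.swap) (rule refl)
  ultimately show ?thesis by (intro exI[of _ n]) simp
qed

text \<open>The inner product is the dimension of the invariants in the conjugate of
  \<open>\<rho>\<close> tensored with \<open>\<sigma>\<close>, obtained as the trace of the
  averaging projection.\<close>

lemma irreducible_characters_inner_nat:
  assumes G: "group \<G>" and fin: "finite (carrier \<G>)"
    and "\<psi> \<in> irreducible_characters \<G>" "\<eta> \<in> irreducible_characters \<G>"
  shows "\<exists>n :: nat. 1 / of_nat (card (carrier \<G>)) * (\<Sum>g\<in>carrier \<G>. cnj (\<psi> g) * \<eta> g) = of_nat n"
proof -
  obtain k \<rho> where \<rho>: "representation \<G> k \<rho>" "\<psi> = restrict (\<lambda>g. mat_trace (\<rho> g)) (carrier \<G>)"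
    using assms(3) unfolding irreducible_characters_def irreducible_representation_def by blast
  obtain l \<sigma> where \<sigma>: "representation \<G> l \<sigma>" "\<eta> = restrict (\<lambda>g. mat_trace (\<sigma> g)) (carrier \<G>)"
    using assms(4) unfolding irreducible_characters_def irreducible_representation_def by blast
  note r = kernel_rep_of_representation[OF G \<rho>(1)] and s = kernel_rep_of_representation[OF G \<sigma>(1)]
  have "(\<Sum>g\<in>carrier \<G>. cnj (\<psi> g) * \<eta> g) = (\<Sum>g\<in>carrier \<G>. \<Sum>p\<in>{..<k} \<times> {..<l}.
      cnj (\<rho> g $$ (fst p, fst p)) * \<sigma> g $$ (snd p, snd p))"
    by (intro sum.cong refl)
      (simp add: \<rho>(2) \<sigma>(2) r(2) s(2) sum_product sum.cartesian_product split_def)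
  then show ?thesis using average_trace_nat[OF G fin kernel_rep_tensor[OF r(1) s(1)]] by (simp only:)
qed

lemma nonneg_Reals_sum_I:
  "(\<And>x. x \<in> A \<Longrightarrow> f x \<in> \<real>\<^sub>\<ge>\<^sub>0) \<Longrightarrow> sum f A \<in> (\<real>\<^sub>\<ge>\<^sub>0 :: 'a::real_normed_algebra_1 set)"
  by (induction A rule: infinite_finite_induct) auto

lemma effective_character_inner_nonneg:
  assumes G: "group \<G>" and fin: "finite (carrier \<G>)"
    and \<psi>: "\<psi> \<in> irreducible_characters \<G>" and \<phi>: "effective_character \<G> \<phi>"
  shows "1 / of_nat (card (carrier \<G>)) * (\<Sum>g\<in>carrier \<G>. cnj (\<psi> g) * \<phi> g) \<in> \<real>\<^sub>\<ge>\<^sub>0"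
proof -
  obtain S m where S: "finite S" "S \<subseteq> irreducible_characters \<G>"
    "\<And>g. g \<in> carrier \<G> \<Longrightarrow> \<phi> g = (\<Sum>\<eta>\<in>S. of_nat (m \<eta>) * \<eta> g)"
    using \<phi> unfolding effective_character_def by blast
  have "(\<Sum>g\<in>carrier \<G>. cnj (\<psi> g) * \<phi> g) =
      (\<Sum>g\<in>carrier \<G>. \<Sum>\<eta>\<in>S. of_nat (m \<eta>) * (cnj (\<psi> g) * \<eta> g))"
    by (intro sum.cong refl) (simp add: S(3) sum_distrib_left mult_ac)
  also have "\<dots> = (\<Sum>\<eta>\<in>S. of_nat (m \<eta>) * (\<Sum>g\<in>carrier \<G>. cnj (\<psi> g) * \<eta> g))"
    by (subst sum.swap) (simp add: sum_distrib_left)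
  finally have eq: "1 / of_nat (card (carrier \<G>)) * (\<Sum>g\<in>carrier \<G>. cnj (\<psi> g) * \<phi> g) =
      (\<Sum>\<eta>\<in>S. of_nat (m \<eta>) * (1 / of_nat (card (carrier \<G>)) * (\<Sum>g\<in>carrier \<G>. cnj (\<psi> g) * \<eta> g)))"
    by (simp add: sum_distrib_left mult_ac)
  show ?thesis unfolding eq
  proof (rule nonneg_Reals_sum_I)
    fix \<eta> assume "\<eta> \<in> S"
    then have "\<eta> \<in> irreducible_characters \<G>" using S(2) by blast
    from irreducible_characters_inner_nat[OF G fin \<psi> this] obtain n where
      "1 / of_nat (card (carrier \<G>)) * (\<Sum>g\<in>carrier \<G>. cnj (\<psi> g) * \<eta> g) = of_nat n" by blast
    then show "of_nat (m \<eta>) * (1 / of_nat (card (carrier \<G>)) * (\<Sum>g\<in>carrier \<G>. cnj (\<psi> g) * \<eta> g)) \<in> \<real>\<^sub>\<ge>\<^sub>0"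
      by simp
  qed
qed

text \<open>Any finite superset \<open>A\<close> of the support may serve as index set; the support
  itself varies with the group element.\<close>

lemma F_expansionI:
  assumes "finite A" "\<And>\<alpha>. \<alpha> \<in> A \<Longrightarrow> composition \<alpha>"
    and "\<And>\<alpha>. composition \<alpha> \<Longrightarrow> c \<alpha> \<noteq> 0 \<Longrightarrow> \<alpha> \<in> A"
    and "\<And>m. q m = (\<Sum>\<alpha>\<in>A. c \<alpha> * qsym_F \<alpha> m)"
  shows "F_expansion q c"
proof -
  have sub: "{\<alpha>. composition \<alpha> \<and> c \<alpha> \<noteq> 0} \<subseteq> A" using assms(3) by blast
  have "q m = (\<Sum>\<alpha> | composition \<alpha> \<and> c \<alpha> \<noteq> 0. c \<alpha> * qsym_F \<alpha> m)" for m
    unfolding assms(4) using assms(1,2) sub by (intro sum.mono_neutral_right) auto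
  then show ?thesis unfolding F_expansion_def using finite_subset[OF sub assms(1)] by auto
qed

lemma F_effective_imp_F_positive:
  assumes G: "group \<G>" and fin: "finite (carrier \<G>)"
    and \<psi>: "\<psi> \<in> irreducible_characters \<G>" and \<chi>: "F_effective \<G> \<chi>"
  shows "F_positive (char_inner \<G> \<psi> \<chi>)"
proof -
  obtain \<phi> where eff: "\<And>\<alpha>. composition \<alpha> \<Longrightarrow> effective_character \<G> (\<phi> \<alpha>)"
    and ex: "\<And>g. g \<in> carrier \<G> \<Longrightarrow> F_expansion (\<chi> g) (\<lambda>\<alpha>. \<phi> \<alpha> g)"
    using \<chi> unfolding F_effective_def by blast
  define c where "c \<alpha> = 1 / of_nat (card (carrier \<G>)) * (\<Sum>g\<in>carrier \<G>. cnj (\<psi> g) * \<phi> \<alpha> g)" for \<alpha>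
  \<comment> \<open>A common finite support for all group elements, so that the sums over
    \<open>g\<close> and over compositions can be exchanged.\<close>
  define A where "A = (\<Union>g\<in>carrier \<G>. {\<alpha>. composition \<alpha> \<and> \<phi> \<alpha> g \<noteq> 0})"
  have fA: "finite A" unfolding A_def using ex fin unfolding F_expansion_def by blast
  have "F_expansion (char_inner \<G> \<psi> \<chi>) c"
  proof (rule F_expansionI[OF fA])
    show "composition \<alpha>" if "\<alpha> \<in> A" for \<alpha> using that by (auto simp: A_def)
    show "\<alpha> \<in> A" if "composition \<alpha>" "c \<alpha> \<noteq> 0" for \<alpha>
    proof (rule ccontr)
      assume "\<alpha> \<notin> A"
      then have "\<phi> \<alpha> g = 0" if "g \<in> carrier \<G>" for g using that \<open>composition \<alpha>\<close> by (auto simp: A_def)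
      then show False using \<open>c \<alpha> \<noteq> 0\<close> by (simp add: c_def)
    qed
    fix m
    have "\<chi> g m = (\<Sum>\<alpha>\<in>A. \<phi> \<alpha> g * qsym_F \<alpha> m)" if g: "g \<in> carrier \<G>" for g
    proof -
      have "\<chi> g m = (\<Sum>\<alpha> | composition \<alpha> \<and> \<phi> \<alpha> g \<noteq> 0. \<phi> \<alpha> g * qsym_F \<alpha> m)"
        using ex[OF g] unfolding F_expansion_def by (metis (no_types, lifting))
      also have "\<dots> = (\<Sum>\<alpha>\<in>A. \<phi> \<alpha> g * qsym_F \<alpha> m)"
        using fA g by (intro sum.mono_neutral_left) (auto simp: A_def)
      finally show ?thesis .
    qed
    then have "(\<Sum>g\<in>carrier \<G>. cnj (\<psi> g) * \<chi> g m) =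
        (\<Sum>g\<in>carrier \<G>. \<Sum>\<alpha>\<in>A. cnj (\<psi> g) * \<phi> \<alpha> g * qsym_F \<alpha> m)"
      by (simp add: sum_distrib_left mult.assoc)
    also have "\<dots> = (\<Sum>\<alpha>\<in>A. (\<Sum>g\<in>carrier \<G>. cnj (\<psi> g) * \<phi> \<alpha> g) * qsym_F \<alpha> m)"
      by (subst sum.swap) (simp add: sum_distrib_right)
    finally show "char_inner \<G> \<psi> \<chi> m = (\<Sum>\<alpha>\<in>A. c \<alpha> * qsym_F \<alpha> m)"
      unfolding char_inner_def c_def mult.assoc sum_distrib_left[symmetric] by (rule arg_cong)
  qed
  then show ?thesis unfolding F_positive_def c_def
    using effective_character_inner_nonneg[OF G fin \<psi> eff] by blast
qed

section \<open>Coefficients of fundamental quasisymmetric functions\<close>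

definition comp_of_monomial :: "monomial \<Rightarrow> nat list" where
  "comp_of_monomial m =
     map (Poly_Mapping.lookup m) (sorted_list_of_set (Poly_Mapping.keys m))"

text \<open>The subset usually attached to a composition, with both end points kept: 0 and the total
  always belong to it.\<close>

definition partial_sums :: "nat list \<Rightarrow> nat set" where
  "partial_sums xs = (\<lambda>i. sum_list (take i xs)) ` {..length xs}"

lemma composition_comp_of_monomial: "composition (comp_of_monomial m)"
  unfolding composition_def comp_of_monomial_def by (auto simp: in_keys_iff)

text \<open>Positive parts at strictly increasing indices neither vanish nor merge: the indices are
  recovered as the support, and the parts as the exponents read in order.\<close>

lemma sum_single_eq_iff:
  assumes \<beta>: "composition \<beta>" and i: "sorted_wrt (<) i" and len: "length i = length \<beta>"
  shows "(\<Sum>j<length \<beta>. Poly_Mapping.single (i ! j) (\<beta> ! j)) = m \<longleftrightarrow>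
    i = sorted_list_of_set (Poly_Mapping.keys m) \<and> \<beta> = comp_of_monomial m"
proof -
  define s where "s = (\<Sum>j<length \<beta>. Poly_Mapping.single (i ! j) (\<beta> ! j))"
  have dist: "distinct i" and sorted: "sorted i"
    using i by (auto simp: strict_sorted_iff)
  have lookup_s: "Poly_Mapping.lookup s x = (\<Sum>j<length \<beta>. \<beta> ! j when i ! j = x)" for x
    unfolding s_def by (simp add: lookup_sum lookup_single)
  have lookup_nth: "Poly_Mapping.lookup s (i ! l) = \<beta> ! l" if l: "l < length \<beta>" for l
  proof -
    have "Poly_Mapping.lookup s (i ! l) = (\<Sum>j<length \<beta>. if j = l then \<beta> ! j else 0)"
      unfolding lookup_s using l len dist by (intro sum.cong) (auto simp: when_def nth_eq_iff_index_eq)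
    then show ?thesis using l by simp
  qed
  have keys_s: "Poly_Mapping.keys s = set i"
  proof (intro equalityI subsetI)
    fix x assume "x \<in> Poly_Mapping.keys s"
    then have "(\<Sum>j<length \<beta>. \<beta> ! j when i ! j = x) \<noteq> 0" by (simp add: in_keys_iff lookup_s)
    then obtain j where "j \<in> {..<length \<beta>}" "(\<beta> ! j when i ! j = x) \<noteq> 0"
      by (rule sum.not_neutral_contains_not_neutral)
    then have "j < length \<beta>" "i ! j = x" by (auto simp: when_def split: if_splits)
    then show "x \<in> set i" using len by auto
  next
    fix x assume "x \<in> set i"
    then obtain j where j: "j < length \<beta>" "x = i ! j" using len by (metis in_set_conv_nth)
    then have "\<beta> ! j > 0" using \<beta> unfolding composition_def by auto
    then show "x \<in> Poly_Mapping.keys s" using j by (simp add: in_keys_iff lookup_nth)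
  qed
  have i_eq: "i = sorted_list_of_set (Poly_Mapping.keys s)"
    unfolding keys_s using sorted dist by (simp add: sorted_list_of_set.idem_if_sorted_distinct)
  have \<beta>_eq: "\<beta> = comp_of_monomial s"
    unfolding comp_of_monomial_def i_eq[symmetric]
    by (rule nth_equalityI) (simp_all add: len lookup_nth)
  have "s = m" if "i = sorted_list_of_set (Poly_Mapping.keys m)" "\<beta> = comp_of_monomial m"
  proof (rule poly_mapping_eqI)
    fix x
    have keys: "Poly_Mapping.keys m = set i" using that(1) by simp
    show "Poly_Mapping.lookup s x = Poly_Mapping.lookup m x"
    proof (cases "x \<in> set i")
      case True
      then obtain j where j: "j < length \<beta>" "x = i ! j" using len by (metis in_set_conv_nth)
      have "\<beta> = map (Poly_Mapping.lookup m) i"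
        unfolding that(1) by (rule that(2)[unfolded comp_of_monomial_def])
      then have "\<beta> ! j = Poly_Mapping.lookup m (i ! j)" using nth_map[of j i] j(1) len by metis
      with lookup_nth[OF j(1)] show ?thesis unfolding j(2) by (rule trans)
    next
      case False
      then show ?thesis using keys keys_s by (metis in_keys_iff)
    qed
  qed
  then show ?thesis using i_eq \<beta>_eq unfolding s_def[symmetric] by blast
qed

lemma qsym_M_eq:
  assumes "composition \<beta>"
  shows "qsym_M \<beta> m = of_bool (\<beta> = comp_of_monomial m \<and> 0 \<notin> Poly_Mapping.keys m)"
proof -
  let ?i = "sorted_list_of_set (Poly_Mapping.keys m)"
  have len: "length ?i = length \<beta>" if "\<beta> = comp_of_monomial m" using that by (simp add: comp_of_monomial_def)
  have "{i :: nat list. length i = length \<beta> \<and> sorted_wrt (<) i \<and> (\<forall>j\<in>set i. j \<ge> 1) \<and>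
      (\<Sum>j<length \<beta>. Poly_Mapping.single (i ! j) (\<beta> ! j)) = m} =
    (if \<beta> = comp_of_monomial m \<and> 0 \<notin> Poly_Mapping.keys m then {?i} else {})" (is "?L = ?R")
  proof (intro equalityI subsetI)
    fix i assume "i \<in> ?L"
    then have i: "length i = length \<beta>" "sorted_wrt (<) i" "\<forall>j\<in>set i. j \<ge> 1"
      "(\<Sum>j<length \<beta>. Poly_Mapping.single (i ! j) (\<beta> ! j)) = m" by blast+
    with sum_single_eq_iff[OF assms i(2,1)] have eq: "i = ?i" "\<beta> = comp_of_monomial m" by blast+
    have "set ?i = Poly_Mapping.keys m" by simp
    then have "0 \<notin> Poly_Mapping.keys m" using i(3) eq(1) by (metis not_one_le_zero)
    then show "i \<in> ?R" using eq by simp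
  next
    fix i assume "i \<in> ?R"
    then have i: "i = ?i" "\<beta> = comp_of_monomial m" "0 \<notin> Poly_Mapping.keys m" by (simp_all split: if_splits)
    have "sorted_wrt (<) ?i" by simp
    moreover have "\<forall>j\<in>set ?i. j \<ge> 1" using i(3) by (auto simp: Suc_le_eq intro: gr0I)
    ultimately show "i \<in> ?L" unfolding i(1)
      using sum_single_eq_iff[OF assms _ len[OF i(2)], of m] i(2) len[OF i(2)] by blast
  qed
  then show ?thesis unfolding qsym_M_def by (simp split: if_splits)
qed

lemma length_le_sum_list: "composition \<beta> \<Longrightarrow> length \<beta> \<le> sum_list \<beta>"
  unfolding composition_def by (induction \<beta>) auto

lemma comp_le_sum_list: "comp_le \<alpha> \<beta> \<Longrightarrow> sum_list \<alpha> = sum_list \<beta>"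
proof -
  have "sum_list (concat bs) = sum_list (map sum_list bs)" for bs :: "nat list list" by (induction bs) auto
  then show "comp_le \<alpha> \<beta> \<Longrightarrow> sum_list \<alpha> = sum_list \<beta>" unfolding comp_le_def by metis
qed

text \<open>A \<open>sum\<close> over an infinite set defaults to 0, so finiteness is what lets the
  sum in \<open>qsym_F\<close> be evaluated term by term.\<close>

lemma finite_refinements: "finite {\<beta>. composition \<beta> \<and> comp_le \<alpha> \<beta>}"
proof (rule finite_subset)
  show "finite {\<beta>. set \<beta> \<subseteq> {..sum_list \<alpha>} \<and> length \<beta> \<le> sum_list \<alpha>}"
    by (rule finite_lists_length_le) simp
  show "{\<beta>. composition \<beta> \<and> comp_le \<alpha> \<beta>} \<subseteq> {\<beta>. set \<beta> \<subseteq> {..sum_list \<alpha>} \<and> length \<beta> \<le> sum_list \<alpha>}"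
    using length_le_sum_list comp_le_sum_list by (auto simp: member_le_sum_list)
qed

lemma qsym_F_eq:
  "qsym_F \<alpha> m = of_bool (comp_le \<alpha> (comp_of_monomial m) \<and> 0 \<notin> Poly_Mapping.keys m)"
proof -
  have "qsym_F \<alpha> m = (\<Sum>\<beta> | composition \<beta> \<and> comp_le \<alpha> \<beta>.
      if \<beta> = comp_of_monomial m then of_bool (0 \<notin> Poly_Mapping.keys m) else 0)"
    unfolding qsym_F_def by (intro sum.cong) (auto simp: qsym_M_eq)
  then show ?thesis using finite_refinements composition_comp_of_monomial
    by (simp add: sum.delta)
qed

section \<open>Refinement as inclusion of partial sums\<close>

lemma comp_le_Nil: "composition \<beta> \<Longrightarrow> comp_le [] \<beta> \<longleftrightarrow> \<beta> = []"
  unfolding comp_le_def by auto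

lemma comp_le_Cons:
  "comp_le (a # \<alpha>) \<beta> \<longleftrightarrow> (\<exists>p s. \<beta> = p @ s \<and> sum_list p = a \<and> comp_le \<alpha> s)"
proof
  assume "comp_le (a # \<alpha>) \<beta>"
  then obtain bs where bs: "concat bs = \<beta>" "map sum_list bs = a # \<alpha>"
    unfolding comp_le_def by (elim exE conjE) (rule that)
  then obtain p bs' where "bs = p # bs'" "sum_list p = a" "map sum_list bs' = \<alpha>"
    unfolding map_eq_Cons_conv by (elim exE conjE) (rule that)
  then show "\<exists>p s. \<beta> = p @ s \<and> sum_list p = a \<and> comp_le \<alpha> s"
    unfolding comp_le_def using bs(1)
    by (intro exI[of _ p] exI[of _ "concat bs'"] conjI exI[of _ bs']) simp_all
next
  assume "\<exists>p s. \<beta> = p @ s \<and> sum_list p = a \<and> comp_le \<alpha> s"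
  then obtain p s bs where "\<beta> = p @ s" "concat bs = s" "sum_list p = a" "map sum_list bs = \<alpha>"
    unfolding comp_le_def by (elim exE conjE) (rule that)
  then show "comp_le (a # \<alpha>) \<beta>" unfolding comp_le_def by (intro exI[of _ "p # bs"]) simp
qed

lemma partial_sums_append:
  "partial_sums (p @ s) = partial_sums p \<union> (+) (sum_list p) ` partial_sums s"
proof (intro equalityI subsetI)
  fix x assume "x \<in> partial_sums (p @ s)"
  then obtain i where i: "i \<le> length p + length s" "x = sum_list (take i (p @ s))"
    unfolding partial_sums_def by auto
  show "x \<in> partial_sums p \<union> (+) (sum_list p) ` partial_sums s"
  proof (cases "i \<le> length p")
    case True
    then show ?thesis using i unfolding partial_sums_def by auto
  next
    case False
    then have "x = sum_list p + sum_list (take (i - length p) s)" "i - length p \<le> length s"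
      using i by auto
    then show ?thesis unfolding partial_sums_def by blast
  qed
next
  fix x assume "x \<in> partial_sums p \<union> (+) (sum_list p) ` partial_sums s"
  then consider i where "i \<le> length p" "x = sum_list (take i p)"
    | i where "i \<le> length s" "x = sum_list p + sum_list (take i s)"
    unfolding partial_sums_def by auto
  then show "x \<in> partial_sums (p @ s)"
  proof cases
    case 1
    then show ?thesis unfolding partial_sums_def by (intro image_eqI[of _ _ i]) auto
  next
    case 2
    then show ?thesis unfolding partial_sums_def by (intro image_eqI[of _ _ "length p + i"]) auto
  qed
qed

lemma partial_sums_Nil: "partial_sums [] = {0}"
  by (simp add: partial_sums_def)

lemma partial_sums_single: "partial_sums [a] = {0, a}"
proof -
  have "{..1::nat} = {0, 1}" by auto
  then show ?thesis by (simp add: partial_sums_def)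
qed

lemma zero_in_partial_sums: "0 \<in> partial_sums xs"
  unfolding partial_sums_def by (intro image_eqI[of _ _ 0]) auto

lemma sum_list_in_partial_sums: "sum_list xs \<in> partial_sums xs"
  unfolding partial_sums_def by (intro image_eqI[of _ _ "length xs"]) auto

lemma partial_sums_le: "x \<in> partial_sums xs \<Longrightarrow> x \<le> sum_list xs"
proof -
  assume "x \<in> partial_sums xs"
  then obtain i where "x = sum_list (take i xs)" unfolding partial_sums_def by blast
  moreover have "sum_list xs = sum_list (take i xs) + sum_list (drop i xs)"
    by (simp flip: sum_list_append)
  ultimately show ?thesis by simp
qed

lemma partial_sums_Cons: "partial_sums (a # \<alpha>) = insert 0 ((+) a ` partial_sums \<alpha>)"
  using partial_sums_append[of "[a]" \<alpha>] zero_in_partial_sums[of \<alpha>]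
  by (auto simp: partial_sums_single)

text \<open>The first part \<open>a\<close> must be a partial sum of \<open>\<beta>\<close>, which
  cuts \<open>\<beta>\<close> into a prefix of sum \<open>a\<close> and a suffix; beyond the prefix,
  partial sums are those of the tails shifted by \<open>a\<close>.\<close>

lemma comp_le_iff:
  assumes "composition \<beta>"
  shows "comp_le \<alpha> \<beta> \<longleftrightarrow> sum_list \<alpha> = sum_list \<beta> \<and> partial_sums \<alpha> \<subseteq> partial_sums \<beta>"
  using assms
proof (induction \<alpha> arbitrary: \<beta>)
  case Nil
  have "sum_list \<beta> = 0 \<longleftrightarrow> \<beta> = []" using length_le_sum_list[OF Nil]
    by (metis le_zero_eq length_0_conv sum_list.Nil)
  then show ?case using comp_le_Nil[OF Nil] zero_in_partial_sums[of \<beta>]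
    unfolding partial_sums_Nil sum_list.Nil by (metis empty_subsetI insert_subset)
next
  case (Cons a \<alpha>)
  show ?case
  proof
    assume "comp_le (a # \<alpha>) \<beta>"
    then obtain p s where ps: "\<beta> = p @ s" "sum_list p = a" "comp_le \<alpha> s"
      unfolding comp_le_Cons by blast
    have "composition s" using Cons.prems ps by (simp add: composition_def)
    with Cons.IH[OF this] ps have "sum_list \<alpha> = sum_list s" "partial_sums \<alpha> \<subseteq> partial_sums s" by auto
    then show "sum_list (a # \<alpha>) = sum_list \<beta> \<and> partial_sums (a # \<alpha>) \<subseteq> partial_sums \<beta>"
      unfolding ps partial_sums_append partial_sums_Cons
      using ps(2) zero_in_partial_sums[of p] by auto
  next
    assume R: "sum_list (a # \<alpha>) = sum_list \<beta> \<and> partial_sums (a # \<alpha>) \<subseteq> partial_sums \<beta>"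
    then have "a \<in> partial_sums \<beta>"
      unfolding partial_sums_Cons using zero_in_partial_sums[of \<alpha>] by force
    then obtain i where i: "i \<le> length \<beta>" "sum_list (take i \<beta>) = a" unfolding partial_sums_def by blast
    define p s where "p = take i \<beta>" and "s = drop i \<beta>"
    have ps: "\<beta> = p @ s" "sum_list p = a" using i by (auto simp: p_def s_def)
    have s: "composition s" using Cons.prems ps by (simp add: composition_def)
    have "sum_list \<alpha> = sum_list s" using R ps by simp
    moreover have "partial_sums \<alpha> \<subseteq> partial_sums s"
    proof
      fix x assume "x \<in> partial_sums \<alpha>"
      then have "a + x \<in> partial_sums p \<union> (+) a ` partial_sums s"
        using R ps unfolding partial_sums_Cons partial_sums_append[of p s, folded ps(1)] by blast
      then consider "a + x \<in> partial_sums p" | "x \<in> partial_sums s" by auto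
      then show "x \<in> partial_sums s"
      proof cases
        case 1
        from partial_sums_le[OF this] ps(2) have "x = 0" by simp
        then show ?thesis by (simp add: zero_in_partial_sums)
      qed
    qed
    ultimately have "comp_le \<alpha> s" using Cons.IH[OF s] by blast
    then show "comp_le (a # \<alpha>) \<beta>" unfolding comp_le_Cons using ps by blast
  qed
qed

section \<open>Levels of a monomial\<close>

definition monomial_level :: "monomial \<Rightarrow> nat \<Rightarrow> nat" where
  "monomial_level m j = (\<Sum>i<j. Poly_Mapping.lookup m i)"

definition monomial_degree :: "monomial \<Rightarrow> nat" where
  "monomial_degree m = (\<Sum>i\<in>Poly_Mapping.keys m. Poly_Mapping.lookup m i)"

lemma sum_list_comp_of_monomial: "sum_list (comp_of_monomial m) = monomial_degree m"
  unfolding comp_of_monomial_def monomial_degree_def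
  by (simp add: sum_list_distinct_conv_sum_set)

lemma takeWhile_less_eq_filter:
  fixes xs :: "'a::linorder list"
  shows "sorted xs \<Longrightarrow> takeWhile (\<lambda>i. i < j) xs = filter (\<lambda>i. i < j) xs"
proof (induction xs)
  case (Cons a xs)
  have "filter (\<lambda>i. i < j) xs = []" if "\<not> a < j"
    using Cons.prems that unfolding filter_empty_conv by auto
  then show ?case using Cons by auto
qed simp

lemma takeWhile_comp_of_monomial:
  "sum_list (map (Poly_Mapping.lookup m)
     (takeWhile (\<lambda>i. i < j) (sorted_list_of_set (Poly_Mapping.keys m)))) = monomial_level m j"
proof -
  let ?l = "sorted_list_of_set (Poly_Mapping.keys m)"
  have eq: "takeWhile (\<lambda>i. i < j) ?l = filter (\<lambda>i. i < j) ?l"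
    by (rule takeWhile_less_eq_filter) simp
  have "sum_list (map (Poly_Mapping.lookup m) (filter (\<lambda>i. i < j) ?l)) =
      (\<Sum>i | i \<in> Poly_Mapping.keys m \<and> i < j. Poly_Mapping.lookup m i)"
    by (subst sum_list_distinct_conv_sum_set) (auto intro!: sum.cong)
  also have "\<dots> = monomial_level m j"
    unfolding monomial_level_def by (intro sum.mono_neutral_left) (auto simp: in_keys_iff)
  finally show ?thesis unfolding eq .
qed

text \<open>Levels are indexed by variables instead of positions in the composition; a variable that
  is absent from \<open>m\<close> merely repeats a level.\<close>

lemma partial_sums_comp_of_monomial:
  "partial_sums (comp_of_monomial m) = range (monomial_level m)"
proof (intro equalityI subsetI)
  let ?l = "sorted_list_of_set (Poly_Mapping.keys m)"
  fix x
  {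
    assume "x \<in> partial_sums (comp_of_monomial m)"
    then obtain i where i: "i \<le> length ?l" "x = sum_list (map (Poly_Mapping.lookup m) (take i ?l))"
      unfolding partial_sums_def comp_of_monomial_def by (auto simp: take_map)
    \<comment> \<open>Cut just before the next variable of the support. If none is left,
      \<open>Suc (sum_list ?l)\<close> exceeds every index in the list.\<close>
    define j where "j = (if i < length ?l then ?l ! i else Suc (sum_list ?l))"
    have "takeWhile (\<lambda>i. i < j) ?l = take i ?l"
    proof (rule takeWhile_eq_take_P_nth)
      show "?l ! k < j" if "k < i" "k < length ?l" for k
      proof (cases "i < length ?l")
        case True
        then show ?thesis using that sorted_wrt_nth_less[of "(<)" ?l k i] by (simp add: j_def)
      next
        case False
        have "?l ! k \<le> sum_list ?l" using that by (intro member_le_sum_list nth_mem zero_le)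
        then show ?thesis using False by (simp add: j_def)
      qed
      show "\<not> ?l ! i < j" if "i < length ?l" using that by (simp add: j_def)
    qed
    then show "x \<in> range (monomial_level m)"
      using takeWhile_comp_of_monomial[of m j] i(2) by (metis rangeI)
  }
  {
    assume "x \<in> range (monomial_level m)"
    then obtain j where j: "x = monomial_level m j" by blast
    let ?i = "length (takeWhile (\<lambda>i. i < j) ?l)"
    have "?i \<le> length (comp_of_monomial m)"
      by (simp add: comp_of_monomial_def length_takeWhile_le del: length_sorted_list_of_set)
    moreover have "x = sum_list (take ?i (comp_of_monomial m))"
      unfolding j takeWhile_comp_of_monomial[symmetric] comp_of_monomial_def take_map
      by (simp flip: takeWhile_eq_take)
    ultimately show "x \<in> partial_sums (comp_of_monomial m)" unfolding partial_sums_def by blast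
  }
qed

lemma qsym_F_eq_levels:
  "qsym_F \<alpha> m = of_bool (0 \<notin> Poly_Mapping.keys m \<and> sum_list \<alpha> = monomial_degree m \<and>
     partial_sums \<alpha> \<subseteq> range (monomial_level m))"
  unfolding qsym_F_eq comp_le_iff[OF composition_comp_of_monomial] sum_list_comp_of_monomial
    partial_sums_comp_of_monomial by (simp add: conj_ac)

text \<open>For each new maximum \<open>b\<close>, append the gap between \<open>b\<close> and the
  current total; it is positive because all earlier partial sums lie below \<open>b\<close>.\<close>

lemma ex_composition_partial_sums:
  assumes "finite D" "0 \<notin> D"
  shows "\<exists>\<alpha>. composition \<alpha> \<and> partial_sums \<alpha> = insert 0 D"
  using assms
proof (induction D rule: finite_linorder_max_induct)
  case empty
  show ?case by (intro exI[of _ "[]"]) (simp add: composition_def partial_sums_Nil)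
next
  case (insert b D)
  then obtain \<alpha> where \<alpha>: "composition \<alpha>" "partial_sums \<alpha> = insert 0 D" by auto
  have "sum_list \<alpha> < b"
    using sum_list_in_partial_sums[of \<alpha>] insert.hyps insert.prems unfolding \<alpha>(2)
    by (metis gr0I insert_iff)
  then have "composition (\<alpha> @ [b - sum_list \<alpha>])" "partial_sums (\<alpha> @ [b - sum_list \<alpha>]) = insert 0 (insert b D)"
    using \<alpha> sum_list_in_partial_sums[of \<alpha>]
    by (auto simp: composition_def partial_sums_append partial_sums_single simp del: sum_list_eq_0_iff)
  then show ?case by blast
qed

section \<open>Group actions that are triangular in a basis\<close>

text \<open>\<open>R\<close> is a grading that may repeat values: distinct points of equal rank do
  not see each other in \<open>e\<close>.\<close>

locale triangular_basis =
  fixes X :: "'x set" and R :: "'x \<Rightarrow> nat" and e :: "'x \<Rightarrow> 'x \<Rightarrow> complex"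
  assumes fin: "finite X"
    and diag: "w \<in> X \<Longrightarrow> e w w = 1"
    and tri: "w \<in> X \<Longrightarrow> x \<in> X \<Longrightarrow> e w x \<noteq> 0 \<Longrightarrow> x = w \<or> R w < R x"
begin

text \<open>Elimination from the lowest rank upwards: subtracting the right multiples of
  \<open>e w\<close> at the lowest rank of the support stays in \<open>V\<close> and clears that
  rank, and \<open>lead\<close> confines the \<open>w\<close> involved to \<open>P\<close>. Taking
  \<open>V\<close> and \<open>P\<close> to be \<open>UNIV\<close> gives spanning of the whole
  space.\<close>

lemma expansion:
  assumes V: "subspace_on X V"
    and eV: "\<And>w. w \<in> P \<Longrightarrow> e w \<in> V"
    and lead: "\<And>\<phi> w. \<phi> \<in> V \<Longrightarrow> w \<in> X \<Longrightarrow> \<phi> w \<noteq> 0 \<Longrightarrow> \<forall>x\<in>X. R x < R w \<longrightarrow> \<phi> x = 0 \<Longrightarrow> w \<in> P"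
    and \<phi>: "\<phi> \<in> V"
  shows "\<exists>c. (\<forall>x\<in>X. \<phi> x = (\<Sum>w\<in>X. c w * e w x)) \<and> (\<forall>w\<in>X. c w \<noteq> 0 \<longrightarrow> w \<in> P)"
proof -
  define M where "M = Suc (Max (insert 0 (R ` X)))"
  have M: "R x < M" if "x \<in> X" for x
    using fin that unfolding M_def by (simp add: less_Suc_eq_le)
  define Q where "Q j \<longleftrightarrow> (\<forall>\<phi>\<in>V. (\<forall>x\<in>X. R x < j \<longrightarrow> \<phi> x = 0) \<longrightarrow>
    (\<exists>c. (\<forall>x\<in>X. \<phi> x = (\<Sum>w\<in>X. c w * e w x)) \<and> (\<forall>w\<in>X. c w \<noteq> 0 \<longrightarrow> w \<in> P)))" for j
  have "Q 0"
  \<comment> \<open>The induction descends from \<open>M\<close>, which exceeds all ranks: a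
    function vanishing below \<open>M\<close> is zero on \<open>X\<close>, and each step admits one
    lower rank into the support.\<close>
  proof (rule inc_induct[of 0 M])
    show "Q M" unfolding Q_def using M by (intro ballI impI exI[of _ "\<lambda>_. 0"]) simp
  next
    fix j assume IH: "Q (Suc j)"
    show "Q j" unfolding Q_def
    proof (intro ballI impI)
      fix \<phi> assume \<phi>: "\<phi> \<in> V" and van: "\<forall>x\<in>X. R x < j \<longrightarrow> \<phi> x = 0"
      define Y where "Y = {w \<in> X. R w = j \<and> \<phi> w \<noteq> 0}"
      have fY: "finite Y" using fin by (simp add: Y_def)
      have YP: "w \<in> P" if "w \<in> Y" for w
        using that van by (intro lead[OF \<phi>, of w]) (auto simp: Y_def)
      define \<phi>' where "\<phi>' = (\<lambda>x. \<phi> x + (-1) * (\<Sum>w\<in>Y. \<phi> w * e w x))"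
      have \<phi>'V: "\<phi>' \<in> V" unfolding \<phi>'_def
        by (intro subspace_onD(2)[OF V] \<phi> subspace_on_sum[OF V fY] eV YP)
      have van': "\<forall>x\<in>X. R x < Suc j \<longrightarrow> \<phi>' x = 0"
      proof (intro ballI impI)
        fix x assume x: "x \<in> X" "R x < Suc j"
        have "\<phi> w * e w x = (if w = x then \<phi> x else 0)" if "w \<in> Y" for w
        proof (cases "w = x")
          case True
          then show ?thesis using diag x by simp
        next
          case False
          have w: "w \<in> X" "R w = j" using that by (simp_all add: Y_def)
          have "e w x = 0"
          proof (rule ccontr)
            assume "e w x \<noteq> 0"
            from tri[OF w(1) x(1) this] show False using False w x by auto
          qed
          then show ?thesis using False by simp
        qed
        then have "(\<Sum>w\<in>Y. \<phi> w * e w x) = (\<Sum>w\<in>Y. if w = x then \<phi> x else 0)" by (rule sum.cong[OF refl])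
        also have "\<dots> = (if x \<in> Y then \<phi> x else 0)" using fY by (rule sum.delta)
        finally show "\<phi>' x = 0" using x van unfolding \<phi>'_def Y_def by (auto simp: less_Suc_eq)
      qed
      obtain c where c: "\<And>x. x \<in> X \<Longrightarrow> \<phi>' x = (\<Sum>w\<in>X. c w * e w x)"
        "\<And>w. w \<in> X \<Longrightarrow> c w \<noteq> 0 \<Longrightarrow> w \<in> P"
        using IH[unfolded Q_def, THEN bspec, OF \<phi>'V, THEN mp, OF van'] by (elim exE conjE) (rule that, auto)
      define d where "d w = c w + (if w \<in> Y then \<phi> w else 0)" for w
      have "\<phi> x = (\<Sum>w\<in>X. d w * e w x)" if x: "x \<in> X" for x
      proof -
        have "(\<Sum>w\<in>X. (if w \<in> Y then \<phi> w else 0) * e w x) = (\<Sum>w\<in>Y. \<phi> w * e w x)"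
          using fin by (intro sum.mono_neutral_cong_right) (auto simp: Y_def)
        then have "(\<Sum>w\<in>X. d w * e w x) = \<phi>' x + (\<Sum>w\<in>Y. \<phi> w * e w x)"
          unfolding c(1)[OF x] d_def distrib_right sum.distrib by simp
        then show ?thesis by (simp add: \<phi>'_def)
      qed
      moreover have "w \<in> P" if "w \<in> X" "d w \<noteq> 0" for w
        using that c(2)[of w] YP[of w] by (auto simp: d_def split: if_splits)
      ultimately show "\<exists>c. (\<forall>x\<in>X. \<phi> x = (\<Sum>w\<in>X. c w * e w x)) \<and> (\<forall>w\<in>X. c w \<noteq> 0 \<longrightarrow> w \<in> P)"
        by (intro exI[of _ d]) simp
    qed
  qed simp
  then show ?thesis using \<phi> unfolding Q_def by simp
qed

text \<open>Evaluate the relation at a point \<open>z\<close> of least rank with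
  \<open>d z \<noteq> 0\<close>: only the term of \<open>z\<close> survives.\<close>

lemma independent:
  assumes "\<And>x. x \<in> X \<Longrightarrow> (\<Sum>w\<in>X. d w * e w x) = 0" "w \<in> X"
  shows "d w = 0"
proof (rule ccontr)
  assume "d w \<noteq> 0"
  then obtain z where z: "z \<in> X" "d z \<noteq> 0" and min: "\<And>x. x \<in> X \<Longrightarrow> d x \<noteq> 0 \<Longrightarrow> R z \<le> R x"
    using ex_has_least_nat[of "\<lambda>z. z \<in> X \<and> d z \<noteq> 0" w R] assms(2) by blast
  have "d v * e v z = (if v = z then d z else 0)" if "v \<in> X" for v
    using tri[OF that z(1)] min[OF that] diag[OF z(1)] by force
  then have "(\<Sum>v\<in>X. d v * e v z) = (\<Sum>v\<in>X. if v = z then d z else 0)" by (rule sum.cong[OF refl])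
  also have "\<dots> = d z" using fin z(1) by simp
  finally show False using assms(1)[OF z(1)] z(2) by simp
qed

text \<open>The inverse of the matrix \<open>e\<close>: \<open>dual w y\<close> is the coordinate at
  \<open>e w\<close> of the indicator of \<open>y\<close>, so pairing a function with
  \<open>dual w\<close> extracts its coordinate.\<close>

definition dual :: "'x \<Rightarrow> 'x \<Rightarrow> complex" where
  "dual = (SOME B. \<forall>x\<in>X. \<forall>y\<in>X. (\<Sum>w\<in>X. B w y * e w x) = of_bool (x = y))"

lemma dual_left:
  assumes "x \<in> X" "y \<in> X"
  shows "(\<Sum>w\<in>X. dual w y * e w x) = of_bool (x = y)"
proof -
  have "\<exists>c. \<forall>x\<in>X. of_bool (x = y) = (\<Sum>w\<in>X. c w * e w x)" for y
    using expansion[of UNIV UNIV "\<lambda>x. of_bool (x = y)"] by (auto simp: subspace_on_def)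
  then obtain C where "\<And>y. \<forall>x\<in>X. of_bool (x = y) = (\<Sum>w\<in>X. C y w * e w x)" by metis
  then have "\<exists>B. \<forall>x\<in>X. \<forall>y\<in>X. (\<Sum>w\<in>X. B w y * e w x) = of_bool (x = y)"
    by (intro exI[of _ "\<lambda>w y. C y w"]) simp
  from someI_ex[OF this, folded dual_def] show ?thesis using assms by (elim ballE) auto
qed

text \<open>A one-sided inverse is two-sided: the discrepancies are the coefficients of a relation
  among the \<open>e w\<close>, and these vanish by independence.\<close>

lemma dual_right:
  assumes "w \<in> X" "v \<in> X"
  shows "(\<Sum>x\<in>X. dual w x * e v x) = of_bool (w = v)"
proof -
  have "(\<Sum>x\<in>X. dual w x * e v x) - of_bool (w = v) = 0"
  proof (rule independent[OF _ assms(1)])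
    fix x assume x: "x \<in> X"
    have "(\<Sum>w\<in>X. ((\<Sum>y\<in>X. dual w y * e v y) - of_bool (w = v)) * e w x) =
        (\<Sum>w\<in>X. \<Sum>y\<in>X. dual w y * e w x * e v y) - (\<Sum>w\<in>X. of_bool (w = v) * e w x)"
      unfolding left_diff_distrib sum_subtractf sum_distrib_right by (simp add: mult_ac)
    also have "(\<Sum>w\<in>X. \<Sum>y\<in>X. dual w y * e w x * e v y) = (\<Sum>y\<in>X. of_bool (x = y) * e v y)"
      by (subst sum.swap) (simp add: sum_distrib_right[symmetric] dual_left x)
    also have "\<dots> = (\<Sum>y\<in>X. if x = y then e v y else 0)" by (intro sum.cong) auto
    also have "\<dots> = e v x" using fin x by simp
    also have "(\<Sum>w\<in>X. of_bool (w = v) * e w x) = (\<Sum>w\<in>X. if w = v then e w x else 0)"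
      by (intro sum.cong) auto
    also have "\<dots> = e v x" using fin assms by simp
    finally show "(\<Sum>w\<in>X. ((\<Sum>y\<in>X. dual w y * e v y) - of_bool (w = v)) * e w x) = 0" by simp
  qed
  then show ?thesis by simp
qed

end

text \<open>\<open>act\<close> is a right action, so precomposing functions with it is a left one
  and no inverses appear. \<open>e_V\<close> and \<open>lead\<close> make the \<open>e w\<close>
  with \<open>D w \<subseteq> S\<close> a basis of \<open>V S\<close>: the first gives membership,
  the second spanning through \<open>expansion\<close>.\<close>

locale triangular_action = triangular_basis X R e
  for X :: "'x set" and R :: "'x \<Rightarrow> nat" and e :: "'x \<Rightarrow> 'x \<Rightarrow> complex" +
  fixes \<G> :: "('g, 'm) monoid_scheme" and act :: "'g \<Rightarrow> 'x \<Rightarrow> 'x"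
    and D :: "'x \<Rightarrow> 'd set" and V :: "'d set \<Rightarrow> ('x \<Rightarrow> complex) set"
  assumes act_closed: "g \<in> carrier \<G> \<Longrightarrow> x \<in> X \<Longrightarrow> act g x \<in> X"
    and act_one: "x \<in> X \<Longrightarrow> act \<one>\<^bsub>\<G>\<^esub> x = x"
    and act_mult: "g \<in> carrier \<G> \<Longrightarrow> h \<in> carrier \<G> \<Longrightarrow> x \<in> X \<Longrightarrow> act (g \<otimes>\<^bsub>\<G>\<^esub> h) x = act h (act g x)"
    and V_subspace: "subspace_on X (V S)"
    and V_act: "g \<in> carrier \<G> \<Longrightarrow> \<phi> \<in> V S \<Longrightarrow> (\<lambda>x. \<phi> (act g x)) \<in> V S"
    and e_V: "w \<in> X \<Longrightarrow> D w \<subseteq> S \<Longrightarrow> e w \<in> V S"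
    and lead: "\<phi> \<in> V S \<Longrightarrow> w \<in> X \<Longrightarrow> \<phi> w \<noteq> 0 \<Longrightarrow> \<forall>x\<in>X. R x < R w \<longrightarrow> \<phi> x = 0 \<Longrightarrow> D w \<subseteq> S"
begin

lemma dual_V:
  assumes \<phi>: "\<phi> \<in> V S" and w: "w \<in> X" "\<not> D w \<subseteq> S"
  shows "(\<Sum>x\<in>X. dual w x * \<phi> x) = 0"
proof -
  have "\<exists>c. (\<forall>x\<in>X. \<phi> x = (\<Sum>w\<in>X. c w * e w x)) \<and> (\<forall>w\<in>X. c w \<noteq> 0 \<longrightarrow> w \<in> {w \<in> X. D w \<subseteq> S})"
    by (rule expansion[OF V_subspace _ _ \<phi>]) (use e_V lead in auto)
  then obtain c where c: "\<And>x. x \<in> X \<Longrightarrow> \<phi> x = (\<Sum>v\<in>X. c v * e v x)"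
    "\<And>w. w \<in> X \<Longrightarrow> c w \<noteq> 0 \<Longrightarrow> D w \<subseteq> S" by blast
  have "(\<Sum>x\<in>X. dual w x * \<phi> x) = (\<Sum>x\<in>X. \<Sum>v\<in>X. c v * (dual w x * e v x))"
    by (intro sum.cong refl) (simp add: c(1) sum_distrib_left mult_ac)
  also have "\<dots> = (\<Sum>v\<in>X. c v * of_bool (w = v))"
    by (subst sum.swap) (simp add: sum_distrib_left[symmetric] dual_right w)
  also have "\<dots> = (\<Sum>v\<in>X. if w = v then c v else 0)" by (intro sum.cong) auto
  also have "\<dots> = c w" using fin w by simp
  finally show ?thesis using c(2) w by metis
qed

text \<open>The matrix, in the basis \<open>e\<close>, of the operator that precomposes with
  \<open>act g\<close>.\<close>

definition coeff_kernel :: "'g \<Rightarrow> 'x \<Rightarrow> 'x \<Rightarrow> complex" where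
  "coeff_kernel g v w = (\<Sum>x\<in>X. dual v x * e w (act g x))"

text \<open>\<open>e w\<close> lies in the invariant space \<open>V (D w)\<close>, whose elements
  have no coordinate at any \<open>v\<close> with \<open>D v\<close> not contained in
  \<open>D w\<close>.\<close>

lemma coeff_kernel_nonzero:
  assumes "g \<in> carrier \<G>" "v \<in> X" "w \<in> X" "coeff_kernel g v w \<noteq> 0"
  shows "D v \<subseteq> D w"
  using dual_V[OF V_act[OF assms(1) e_V[OF assms(3) subset_refl]] assms(2)] assms(4)
  unfolding coeff_kernel_def by blast

lemma coeff_kernel_mult:
  assumes g: "g \<in> carrier \<G>" "h \<in> carrier \<G>" and w: "v \<in> X" "w \<in> X"
  shows "coeff_kernel (g \<otimes>\<^bsub>\<G>\<^esub> h) v w = (\<Sum>u\<in>X. coeff_kernel g v u * coeff_kernel h u w)"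
proof -
  have "(\<Sum>u\<in>X. coeff_kernel g v u * coeff_kernel h u w) =
      (\<Sum>u\<in>X. \<Sum>x\<in>X. \<Sum>y\<in>X. dual v x * (dual u y * e u (act g x)) * e w (act h y))"
    unfolding coeff_kernel_def sum_product by (simp add: mult_ac)
  also have "\<dots> = (\<Sum>x\<in>X. \<Sum>y\<in>X. \<Sum>u\<in>X. dual v x * (dual u y * e u (act g x)) * e w (act h y))"
    by (subst sum.swap, rule sum.cong[OF refl], rule sum.swap)
  also have "\<dots> = (\<Sum>x\<in>X. \<Sum>y\<in>X. if act g x = y then dual v x * e w (act h y) else 0)"
    by (intro sum.cong refl)
      (simp add: sum_distrib_right[symmetric] sum_distrib_left[symmetric] dual_left act_closed g of_bool_def)
  also have "\<dots> = (\<Sum>x\<in>X. dual v x * e w (act h (act g x)))"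
    using fin by (intro sum.cong refl) (simp add: act_closed g)
  finally show ?thesis by (simp add: coeff_kernel_def act_mult g)
qed

text \<open>An index \<open>l\<close> contributing to a product between two indices with descent set
  \<open>E\<close> has \<open>E \<subseteq> D l\<close> and \<open>D l \<subseteq> E\<close>, so the
  product never leaves the block.\<close>

lemma kernel_rep_block:
  assumes one: "\<one>\<^bsub>\<G>\<^esub> \<in> carrier \<G>"
  shows "kernel_rep \<G> {w \<in> X. D w = E} coeff_kernel"
  unfolding kernel_rep_def
proof (intro conjI ballI)
  let ?I = "{w \<in> X. D w = E}"
  show "finite ?I" using fin by simp
  show "coeff_kernel \<one>\<^bsub>\<G>\<^esub> i j = of_bool (i = j)" if "i \<in> ?I" "j \<in> ?I" for i j
    using that by (simp add: coeff_kernel_def act_one dual_right)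
  show "coeff_kernel (g \<otimes>\<^bsub>\<G>\<^esub> h) i j = (\<Sum>l\<in>?I. coeff_kernel g i l * coeff_kernel h l j)"
    if "g \<in> carrier \<G>" "h \<in> carrier \<G>" "i \<in> ?I" "j \<in> ?I" for g h i j
  proof -
    have ij: "i \<in> X" "j \<in> X" "D i = E" "D j = E" using that by auto
    have "coeff_kernel g i l * coeff_kernel h l j = 0" if l: "l \<in> X - ?I" for l
    proof (rule ccontr)
      assume "coeff_kernel g i l * coeff_kernel h l j \<noteq> 0"
      then have "E \<subseteq> D l" "D l \<subseteq> E"
        using coeff_kernel_nonzero[of g i l] coeff_kernel_nonzero[of h l j] ij l
          \<open>g \<in> carrier \<G>\<close> \<open>h \<in> carrier \<G>\<close> by auto
      then show False using l by auto
    qed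
    then show ?thesis unfolding coeff_kernel_mult[OF that(1,2) ij(1,2)]
      using fin by (intro sum.mono_neutral_right) auto
  qed
qed

text \<open>The trace of \<open>g\<close> on \<open>V S\<close> in two bases: the \<open>e w\<close>
  with \<open>D w \<subseteq> S\<close>, and the \<open>b f\<close>, whose coordinates are the
  values at the points \<open>rep f\<close>.\<close>

lemma trace_V:
  assumes g: "g \<in> carrier \<G>" and Y: "finite Y"
    and rep: "\<And>f. f \<in> Y \<Longrightarrow> rep f \<in> X" and b: "\<And>f. f \<in> Y \<Longrightarrow> b f \<in> V S"
    and span: "\<And>\<phi> x. \<phi> \<in> V S \<Longrightarrow> x \<in> X \<Longrightarrow> \<phi> x = (\<Sum>f\<in>Y. \<phi> (rep f) * b f x)"
  shows "(\<Sum>w | w \<in> X \<and> D w \<subseteq> S. coeff_kernel g w w) = (\<Sum>f\<in>Y. b f (act g (rep f)))"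
proof -
  let ?P = "{w \<in> X. D w \<subseteq> S}"
  define \<beta> where "\<beta> w f = (\<Sum>x\<in>X. dual w x * b f (act g x))" for w f
  have "(\<Sum>w\<in>?P. coeff_kernel g w w) = (\<Sum>w\<in>?P. \<Sum>f\<in>Y. e w (rep f) * \<beta> w f)"
  proof (rule sum.cong[OF refl])
    fix w assume "w \<in> ?P"
    then have "e w \<in> V S" by (simp add: e_V)
    then have "coeff_kernel g w w = (\<Sum>x\<in>X. dual w x * (\<Sum>f\<in>Y. e w (rep f) * b f (act g x)))"
      unfolding coeff_kernel_def by (intro sum.cong refl arg_cong2[of _ _ _ _ times] span act_closed g)
    also have "\<dots> = (\<Sum>x\<in>X. \<Sum>f\<in>Y. e w (rep f) * (dual w x * b f (act g x)))"
      by (simp add: sum_distrib_left mult_ac)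
    also have "\<dots> = (\<Sum>f\<in>Y. e w (rep f) * \<beta> w f)"
      unfolding \<beta>_def by (subst sum.swap) (simp add: sum_distrib_left)
    finally show "coeff_kernel g w w = (\<Sum>f\<in>Y. e w (rep f) * \<beta> w f)" .
  qed
  also have "\<dots> = (\<Sum>f\<in>Y. \<Sum>w\<in>?P. e w (rep f) * \<beta> w f)" by (rule sum.swap)
  also have "\<dots> = (\<Sum>f\<in>Y. b f (act g (rep f)))"
  proof (rule sum.cong[OF refl])
    fix f assume f: "f \<in> Y"
    \<comment> \<open>Elements of \<open>V S\<close> have coordinate 0 off \<open>?P\<close>, so the
      sum extends to all of \<open>X\<close>, where \<open>dual_left\<close> evaluates it.\<close>
    have "\<beta> w f = 0" if "w \<in> X - ?P" for w
      unfolding \<beta>_def by (rule dual_V[OF V_act[OF g b[OF f]]]) (use that in auto)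
    then have "(\<Sum>w\<in>?P. e w (rep f) * \<beta> w f) = (\<Sum>w\<in>X. e w (rep f) * \<beta> w f)"
      using fin by (intro sum.mono_neutral_left) auto
    also have "\<dots> = (\<Sum>w\<in>X. \<Sum>x\<in>X. dual w x * e w (rep f) * b f (act g x))"
      by (simp add: \<beta>_def sum_distrib_left mult_ac)
    also have "\<dots> = (\<Sum>x\<in>X. of_bool (rep f = x) * b f (act g x))"
      by (subst sum.swap) (simp add: sum_distrib_right[symmetric] dual_left rep f)
    also have "\<dots> = (\<Sum>x\<in>X. if rep f = x then b f (act g x) else 0)" by (intro sum.cong) auto
    also have "\<dots> = b f (act g (rep f))" using fin rep[OF f] by simp
    finally show "(\<Sum>w\<in>?P. e w (rep f) * \<beta> w f) = b f (act g (rep f))" .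
  qed
  finally show ?thesis .
qed

end

section \<open>Numberings of a finite set\<close>

definition level_eq :: "'a set \<Rightarrow> nat set \<Rightarrow> ('a \<Rightarrow> nat) \<Rightarrow> ('a \<Rightarrow> nat) \<Rightarrow> bool" where
  "level_eq N S w w' \<longleftrightarrow> (\<forall>d\<in>S. \<forall>v\<in>N. w v \<le> d \<longleftrightarrow> w' v \<le> d)"

definition numberings :: "'a set \<Rightarrow> ('a \<Rightarrow> nat) set" where
  "numberings N = {w \<in> extensional N. bij_betw w N {1..card N}}"

text \<open>The usual descent set of the word of labels read in the order \<open>w\<close>, for
  labels running opposite to \<open>y\<close>; hence a descent is a step at which \<open>y\<close>
  increases.\<close>

definition descents :: "'a set \<Rightarrow> ('a \<Rightarrow> nat) \<Rightarrow> ('a \<Rightarrow> nat) \<Rightarrow> nat set" where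
  "descents N y w = {i. \<exists>u\<in>N. \<exists>v\<in>N. w u = i \<and> w v = Suc i \<and> y u < y v}"

lemma level_eq_refl: "level_eq N S w w"
  by (simp add: level_eq_def)

lemma level_eq_sym: "level_eq N S w w' \<Longrightarrow> level_eq N S w' w"
  by (simp add: level_eq_def)

lemma level_eq_trans: "level_eq N S w w' \<Longrightarrow> level_eq N S w' w'' \<Longrightarrow> level_eq N S w w''"
  by (simp add: level_eq_def)

lemma level_eq_mono: "level_eq N S w w' \<Longrightarrow> T \<subseteq> S \<Longrightarrow> level_eq N T w w'"
  unfolding level_eq_def by blast

lemma level_eqD: "level_eq N S w w' \<Longrightarrow> d \<in> S \<Longrightarrow> v \<in> N \<Longrightarrow> w v \<le> d \<longleftrightarrow> w' v \<le> d"
  unfolding level_eq_def by blast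

lemma numberingsD:
  assumes "w \<in> numberings N"
  shows "w \<in> extensional N" "bij_betw w N {1..card N}" "inj_on w N" "w ` N = {1..card N}"
    "\<And>v. v \<in> N \<Longrightarrow> 1 \<le> w v \<and> w v \<le> card N"
  using assms by (auto simp: numberings_def bij_betw_def)

lemma finite_numberings:
  assumes "finite N"
  shows "finite (numberings N)"
proof (rule finite_subset)
  show "numberings N \<subseteq> N \<rightarrow>\<^sub>E {1..card N}"
    by (auto simp: numberings_def bij_betw_def PiE_def)
  show "finite (N \<rightarrow>\<^sub>E {1..card N})" using assms by (simp add: finite_PiE)
qed

lemma descents_subset:
  assumes "w \<in> numberings N"
  shows "descents N y w \<subseteq> {1..<card N}"
proof
  fix i assume "i \<in> descents N y w"
  then obtain u v where "u \<in> N" "v \<in> N" "w u = i" "w v = Suc i" unfolding descents_def by blast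
  then show "i \<in> {1..<card N}" using numberingsD(5)[OF assms, of u] numberingsD(5)[OF assms, of v] by simp
qed

text \<open>A step that is not a descent lowers \<open>y\<close>, so \<open>y\<close> falls along
  every stretch free of descents; the induction is on the length of the stretch.\<close>

lemma reversed_between_descents:
  assumes w: "w \<in> numberings N" and y: "inj_on y N" and u: "u \<in> N" and v: "v \<in> N"
    and "w u < w v" and "\<And>d. d \<in> descents N y w \<Longrightarrow> w u \<le> d \<Longrightarrow> w v \<le> d"
  shows "y v < y u"
proof -
  have "y v < y u" if "w v = w u + Suc j" "v \<in> N"
    "\<And>d. d \<in> descents N y w \<Longrightarrow> w u \<le> d \<Longrightarrow> w v \<le> d" for j v
    using that
  proof (induction j arbitrary: v)
    case 0
    have "w u \<notin> descents N y w" using 0(1) 0(3)[of "w u"] by auto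
    then have "\<not> y u < y v" using 0(1,2) u unfolding descents_def by auto
    moreover have "y u \<noteq> y v"
    proof
      assume "y u = y v"
      then have "u = v" using y u 0(2) by (simp add: inj_on_def)
      then show False using 0(1) by simp
    qed
    ultimately show ?case by simp
  next
    case (Suc j)
    have "w u + Suc j \<in> {1..card N}" using numberingsD(5)[OF w Suc.prems(2)] Suc.prems(1) by simp
    then obtain v' where v': "v' \<in> N" "w v' = w u + Suc j"
      using numberingsD(4)[OF w] by (metis imageE)
    have "y v' < y u"
    proof (rule Suc.IH[OF v'(2,1)])
      fix d assume "d \<in> descents N y w" "w u \<le> d"
      from Suc.prems(3)[OF this] show "w v' \<le> d" using v' Suc.prems(1) by simp
    qed
    have "w v' \<notin> descents N y w" using Suc.prems(3)[of "w v'"] v' Suc.prems(1) by auto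
    then have "\<not> y v' < y v" using Suc.prems(1,2) v' unfolding descents_def by auto
    with \<open>y v' < y u\<close> show ?case
      by simp
  qed
  from this[of v "w v - w u - 1"] show ?thesis using assms by simp
qed

lemma card_le_numbering:
  assumes w: "w \<in> numberings N" and v: "v \<in> N"
  shows "card {u \<in> N. w u \<le> w v} = w v"
proof -
  have "w ` {u \<in> N. w u \<le> w v} = {1..w v}"
  proof (intro equalityI subsetI)
    fix p assume "p \<in> w ` {u \<in> N. w u \<le> w v}"
    then show "p \<in> {1..w v}" using numberingsD(5)[OF w] by auto
  next
    fix p assume p: "p \<in> {1..w v}"
    then have "p \<in> w ` N" using numberingsD(4)[OF w] numberingsD(5)[OF w v] by auto
    then show "p \<in> w ` {u \<in> N. w u \<le> w v}" using p by auto
  qed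
  moreover have "inj_on w {u \<in> N. w u \<le> w v}" using numberingsD(3)[OF w] by (rule inj_on_subset) auto
  ultimately show ?thesis using card_image[of w "{u \<in> N. w u \<le> w v}"] by simp
qed

lemma numberings_eqI:
  assumes w: "w \<in> numberings N" and z: "z \<in> numberings N"
    and mono: "\<And>u v. u \<in> N \<Longrightarrow> v \<in> N \<Longrightarrow> w u < w v \<Longrightarrow> z u < z v"
  shows "w = z"
proof (rule extensionalityI[OF numberingsD(1)[OF w] numberingsD(1)[OF z]])
  fix v assume v: "v \<in> N"
  have "w u \<le> w v \<longleftrightarrow> z u \<le> z v" if u: "u \<in> N" for u
  proof (cases "w u = w v")
    case True
    then have "u = v" using numberingsD(3)[OF w] u v by (simp add: inj_on_def)
    then show ?thesis by simp
  next
    case False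
    then show ?thesis using mono[OF u v] mono[OF v u] by linarith
  qed
  then have "{u \<in> N. w u \<le> w v} = {u \<in> N. z u \<le> z v}" by blast
  then show "w v = z v" using card_le_numbering[OF w v] card_le_numbering[OF z v] by simp
qed

text \<open>Vertices separated by a level are ordered by it, and those in a common block are ordered
  by decreasing \<open>y\<close> in both numberings; so all comparisons are forced.\<close>

lemma numberings_unique:
  assumes w: "w \<in> numberings N" and z: "z \<in> numberings N" and y: "inj_on y N"
    and eq: "level_eq N S w z" and S: "descents N y w \<subseteq> S" "descents N y z \<subseteq> S"
  shows "w = z"
proof (rule numberings_eqI[OF w z])
  fix u v assume uv: "u \<in> N" "v \<in> N" and less: "w u < w v"
  show "z u < z v"
  proof (cases "\<exists>d\<in>S. w u \<le> d \<and> \<not> w v \<le> d")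
    case True
    then obtain d where "d \<in> S" "w u \<le> d" "\<not> w v \<le> d" by blast
    then show ?thesis using level_eqD[OF eq \<open>d \<in> S\<close>] uv by (metis le_less_trans not_le)
  next
    case False
    have yvu: "y v < y u" by (rule reversed_between_descents[OF w y uv less]) (use False S in blast)
    show ?thesis
    proof (rule ccontr)
      assume "\<not> z u < z v"
      moreover have "z u \<noteq> z v"
      proof
        assume "z u = z v"
        then have "u = v" using numberingsD(3)[OF z] uv by (simp add: inj_on_def)
        then show False using less by simp
      qed
      ultimately have zvu: "z v < z u" by simp
      have "y u < y v"
      proof (rule reversed_between_descents[OF z y uv(2,1) zvu])
        fix d assume d: "d \<in> descents N y z" "z v \<le> d"
        then have "w v \<le> d" using level_eqD[OF eq, of d v] S uv by blast
        then have "w u \<le> d" using less by simp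
        then show "z u \<le> d" using level_eqD[OF eq, of d u] S uv d by blast
      qed
      then show False using yvu by simp
    qed
  qed
qed

text \<open>By rearrangement it is small when \<open>w\<close> runs against \<open>y\<close>; it
  supplies the rank of the triangular basis.\<close>

definition weight :: "'a set \<Rightarrow> ('a \<Rightarrow> nat) \<Rightarrow> ('a \<Rightarrow> nat) \<Rightarrow> nat" where
  "weight N y w = (\<Sum>v\<in>N. w v * y v)"

text \<open>Exchanging the values \<open>i\<close> and \<open>Suc i\<close> changes only the lower
  set at level \<open>i\<close>, which is not in \<open>S\<close>, and lowers the weight by
  \<open>y v - y u\<close>.\<close>

lemma numbering_swap:
  assumes N: "finite N" and w: "w \<in> numberings N" and i: "i \<in> descents N y w" "i \<notin> S"
  shows "\<exists>w'\<in>numberings N. level_eq N S w w' \<and> weight N y w' < weight N y w"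
proof -
  obtain u v where uv: "u \<in> N" "v \<in> N" "w u = i" "w v = Suc i" "y u < y v"
    using i(1) unfolding descents_def by blast
  have ne: "u \<noteq> v" using uv(3,4) by auto
  define w' where "w' = w(u := Suc i, v := i)"
  have w'N: "w' ` N = w ` N"
  proof (intro equalityI subsetI)
    fix p assume "p \<in> w' ` N"
    then obtain a where "a \<in> N" "p = w' a" by blast
    then have "p = w a \<or> p = w u \<or> p = w v" using uv unfolding w'_def by (auto split: if_splits)
    then show "p \<in> w ` N" using \<open>a \<in> N\<close> uv(1,2) by blast
  next
    fix p assume "p \<in> w ` N"
    then obtain a where a: "a \<in> N" "p = w a" by blast
    consider "a = u" | "a = v" | "a \<noteq> u" "a \<noteq> v" by blast
    then show "p \<in> w' ` N"
    proof cases
      case 1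
      then have "p = w' v" using a uv by (simp add: w'_def)
      then show ?thesis using uv(2) by blast
    next
      case 2
      then have "p = w' u" using a uv ne by (simp add: w'_def)
      then show ?thesis using uv(1) by blast
    next
      case 3
      then have "p = w' a" using a by (simp add: w'_def)
      then show ?thesis using a(1) by blast
    qed
  qed
  have "inj_on w' N"
    by (rule eq_card_imp_inj_on[OF N]) (simp add: w'N card_image[OF numberingsD(3)[OF w]])
  then have "w' \<in> numberings N"
    using w'N numberingsD[OF w] uv unfolding numberings_def bij_betw_def
    by (auto simp: w'_def extensional_def)
  moreover have "level_eq N S w w'" unfolding level_eq_def
  proof (intro ballI)
    fix d a assume "d \<in> S" "a \<in> N"
    then have "d \<noteq> i" using i(2) by blast
    then show "w a \<le> d \<longleftrightarrow> w' a \<le> d" using uv ne by (auto simp: w'_def)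
  qed
  moreover have "weight N y w' < weight N y w"
  proof -
    have split: "weight N y x = (\<Sum>a\<in>N - {u} - {v}. x a * y a) + (x u * y u + x v * y v)" for x
      unfolding weight_def using N uv ne by (simp add: sum.remove[of N u] sum.remove[of "N - {u}" v])
    have "(\<Sum>a\<in>N - {u} - {v}. w' a * y a) = (\<Sum>a\<in>N - {u} - {v}. w a * y a)"
      by (intro sum.cong) (auto simp: w'_def)
    then show ?thesis unfolding split[of w] split[of w'] using uv ne by (simp add: w'_def)
  qed
  ultimately show ?thesis by blast
qed

text \<open>Among all numberings with the same level sets, the one of least weight lists each level
  decreasingly with respect to the reference \<open>y\<close>; it is the only one whose descents are levels.\<close>

lemma numbering_weight_minimal:
  assumes N: "finite N" and w: "w \<in> numberings N" and x: "x \<in> numberings N" and y: "inj_on y N"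
    and eq: "level_eq N S w x" and S: "descents N y w \<subseteq> S"
  shows "x = w \<or> weight N y w < weight N y x"
proof -
  \<comment> \<open>A numbering of least weight in its class admits no exchange outside
    \<open>S\<close>, so its descents lie in \<open>S\<close> and uniqueness identifies it with
    \<open>w\<close>.\<close>
  have min: "z = w" if z: "z \<in> numberings N" "level_eq N S w z"
    and least: "\<And>x. x \<in> numberings N \<Longrightarrow> level_eq N S w x \<Longrightarrow> weight N y z \<le> weight N y x" for z
  proof -
    have "descents N y z \<subseteq> S"
    proof (rule ccontr)
      assume "\<not> descents N y z \<subseteq> S"
      then obtain i where "i \<in> descents N y z" "i \<notin> S" by blast
      from numbering_swap[OF N z(1) this] obtain w' where
        "w' \<in> numberings N" "level_eq N S z w'" "weight N y w' < weight N y z" by blast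
      with least[of w'] level_eq_trans[OF z(2)] show False by fastforce
    qed
    then show ?thesis using numberings_unique[OF w z(1) y z(2) S] by simp
  qed
  obtain z where z: "z \<in> numberings N" "level_eq N S w z"
    and least: "\<And>x. x \<in> numberings N \<Longrightarrow> level_eq N S w x \<Longrightarrow> weight N y z \<le> weight N y x"
    using ex_has_least_nat[of "\<lambda>x. x \<in> numberings N \<and> level_eq N S w x" x "weight N y"] x eq by blast
  have zw: "z = w" by (rule min[OF z least])
  show ?thesis
  proof (cases "weight N y w < weight N y x")
    case False
    \<comment> \<open>If \<open>x\<close> is not heavier than \<open>w\<close>, then
      \<open>x\<close> has least weight too.\<close>
    have "x = w"
    proof (rule min[OF x eq])
      fix x' assume "x' \<in> numberings N" "level_eq N S w x'"
      from least[OF this] show "weight N y x \<le> weight N y x'" using False zw by simp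
    qed
    then show ?thesis by simp
  qed simp
qed

lemma ex_numbering:
  fixes key :: "'a \<Rightarrow> nat"
  assumes N: "finite N" and key: "inj_on key N"
  shows "\<exists>w\<in>numberings N. \<forall>u\<in>N. \<forall>v\<in>N. key u < key v \<longrightarrow> w u < w v"
proof -
  define w where "w = restrict (\<lambda>v. card {u \<in> N. key u \<le> key v}) N"
  have mono: "w u < w v" if "u \<in> N" "v \<in> N" "key u < key v" for u v
  proof -
    have "{a \<in> N. key a \<le> key u} \<subseteq> {a \<in> N. key a \<le> key v}" using that(3) by auto
    moreover have "v \<in> {a \<in> N. key a \<le> key v}" "v \<notin> {a \<in> N. key a \<le> key u}"
      using that(2,3) by simp_all
    ultimately have "{a \<in> N. key a \<le> key u} \<subset> {a \<in> N. key a \<le> key v}" by blast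
    then show ?thesis using that N unfolding w_def by (simp add: psubset_card_mono)
  qed
  have "inj_on w N"
  proof (rule inj_onI)
    fix u v assume uv: "u \<in> N" "v \<in> N" "w u = w v"
    then have "key u = key v" using mono[of u v] mono[of v u] by (metis less_irrefl linorder_neqE_nat)
    then show "u = v" using key uv by (simp add: inj_on_def)
  qed
  moreover have "w ` N \<subseteq> {1..card N}"
  proof
    fix p assume "p \<in> w ` N"
    then obtain v where v: "v \<in> N" "p = card {u \<in> N. key u \<le> key v}" by (auto simp: w_def)
    have "{u \<in> N. key u \<le> key v} \<noteq> {}" using v(1) by blast
    then have "p \<noteq> 0" using N v(2) by simp
    moreover have "p \<le> card N" using N v(2) by (simp add: card_mono)
    ultimately show "p \<in> {1..card N}" by simp
  qed
  ultimately have "bij_betw w N {1..card N}"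
    unfolding bij_betw_def using card_image[of w N] by (simp add: card_subset_eq)
  then have "w \<in> numberings N" by (simp add: numberings_def w_def)
  then show ?thesis using mono by blast
qed

section \<open>Numberings of a digraph\<close>

text \<open>Says that one colour for each block cut out by \<open>S\<close> gives adjacent vertices
  different colours.\<close>

definition separated :: "'a pair_pre_digraph \<Rightarrow> nat set \<Rightarrow> ('a \<Rightarrow> nat) \<Rightarrow> bool" where
  "separated G S w \<longleftrightarrow> (\<forall>(u, v)\<in>parcs G. \<exists>d\<in>S. (w u \<le> d) \<noteq> (w v \<le> d))"

text \<open>When adjacent vertices have distinct values, this set encodes the acyclic orientation
  induced by \<open>w\<close>.\<close>

definition asc_arcs :: "'a pair_pre_digraph \<Rightarrow> ('a \<Rightarrow> nat) \<Rightarrow> ('a \<times> 'a) set" where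
  "asc_arcs G w = {(u, v) \<in> parcs G. w u > w v}"

lemma asc_eq_card: "asc G w = card (asc_arcs G w)"
  by (simp add: asc_def asc_arcs_def)

lemma asc_arcs_cong:
  "(\<And>u v. (u, v) \<in> parcs G \<Longrightarrow> w u > w v \<longleftrightarrow> w' u > w' v) \<Longrightarrow> asc_arcs G w = asc_arcs G w'"
  unfolding asc_arcs_def by auto

lemma numbering_in_colorings:
  assumes "w \<in> numberings (pverts G)" "\<And>u v. (u, v) \<in> parcs G \<Longrightarrow> w u \<noteq> w v"
  shows "w \<in> colorings G"
  using assms numberingsD[OF assms(1)] unfolding colorings_def by (auto simp: PiE_def Pi_def)

lemma coloringsD:
  assumes "f \<in> colorings G"
  shows "f \<in> extensional (pverts G)" "v \<in> pverts G \<Longrightarrow> f v \<ge> 1" "(u, v) \<in> parcs G \<Longrightarrow> f u \<noteq> f v"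
  using assms unfolding colorings_def by (auto simp: PiE_def Pi_def)

lemma digraph_autD:
  assumes "g \<in> digraph_aut G"
  shows "g \<in> Bij (pverts G)" "g \<in> pverts G \<rightarrow> pverts G" "inj_on g (pverts G)" "g ` pverts G = pverts G"
    "u \<in> pverts G \<Longrightarrow> v \<in> pverts G \<Longrightarrow> (u, v) \<in> parcs G \<longleftrightarrow> (g u, g v) \<in> parcs G"
  using assms unfolding digraph_aut_def Bij_def bij_betw_def by auto

lemma group_digraph_aut_group: "group (digraph_aut_group G)"
proof -
  let ?N = "pverts G"
  interpret B: group "BijGroup ?N" by (rule group_BijGroup)
  have mult: "g \<otimes>\<^bsub>BijGroup ?N\<^esub> h = compose ?N g h" if "g \<in> Bij ?N" "h \<in> Bij ?N" for g h
    using that by (simp add: BijGroup_def)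
  have "subgroup (digraph_aut G) (BijGroup ?N)"
  proof (rule B.subgroupI)
    show "digraph_aut G \<subseteq> carrier (BijGroup ?N)"
      by (auto simp: digraph_aut_def BijGroup_def)
    have "(\<lambda>x\<in>?N. x) \<in> digraph_aut G" unfolding digraph_aut_def using id_Bij by auto
    then show "digraph_aut G \<noteq> {}" by blast
  next
    fix g assume g: "g \<in> digraph_aut G"
    let ?h = "\<lambda>x\<in>?N. inv_into ?N g x"
    have inv: "inv\<^bsub>BijGroup ?N\<^esub> g = ?h"
    proof (rule B.inv_equality)
      show "?h \<otimes>\<^bsub>BijGroup ?N\<^esub> g = \<one>\<^bsub>BijGroup ?N\<^esub>"
        unfolding mult[OF restrict_inv_into_Bij[OF digraph_autD(1)[OF g]] digraph_autD(1)[OF g]]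
        using Bij_compose_restrict_eq[OF digraph_autD(1)[OF g]] by (simp add: BijGroup_def)
    qed (use digraph_autD(1)[OF g] restrict_inv_into_Bij in \<open>auto simp: BijGroup_def\<close>)
    have "(u, v) \<in> parcs G \<longleftrightarrow> (?h u, ?h v) \<in> parcs G" if uv: "u \<in> ?N" "v \<in> ?N" for u v
    proof -
      have "inv_into ?N g u \<in> ?N" "inv_into ?N g v \<in> ?N" "g (inv_into ?N g u) = u" "g (inv_into ?N g v) = v"
        using digraph_autD(4)[OF g] uv by (auto intro: inv_into_into f_inv_into_f)
      then show ?thesis using digraph_autD(5)[OF g, of "inv_into ?N g u" "inv_into ?N g v"] uv by simp
    qed
    then show "inv\<^bsub>BijGroup ?N\<^esub> g \<in> digraph_aut G"
      unfolding inv digraph_aut_def using restrict_inv_into_Bij[OF digraph_autD(1)[OF g]] by blast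
  next
    fix g h assume gh: "g \<in> digraph_aut G" "h \<in> digraph_aut G"
    have "compose ?N g h \<in> Bij ?N" by (intro compose_Bij digraph_autD(1) gh)
    moreover have "(u, v) \<in> parcs G \<longleftrightarrow> (compose ?N g h u, compose ?N g h v) \<in> parcs G"
      if uv: "u \<in> ?N" "v \<in> ?N" for u v
    proof -
      have "h u \<in> ?N" "h v \<in> ?N" using digraph_autD(2)[OF gh(2)] uv by blast+
      then show ?thesis
        using digraph_autD(5)[OF gh(2) uv] digraph_autD(5)[OF gh(1), of "h u" "h v"] uv
        by (simp add: compose_def)
    qed
    ultimately show "g \<otimes>\<^bsub>BijGroup ?N\<^esub> h \<in> digraph_aut G"
      unfolding mult[OF digraph_autD(1)[OF gh(1)] digraph_autD(1)[OF gh(2)]] digraph_aut_def by blast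
  qed
  then show ?thesis unfolding digraph_aut_group_def by (rule B.subgroup_imp_group)
qed

lemma compose_digraph_aut:
  assumes "g \<in> digraph_aut G"
  shows "v \<in> pverts G \<Longrightarrow> compose (pverts G) f g v = f (g v)"
    and "v \<in> pverts G \<Longrightarrow> g v \<in> pverts G"
    and "compose (pverts G) f g \<in> extensional (pverts G)"
  using digraph_autD(2)[OF assms] by (auto simp: compose_def)

locale digraph_numberings =
  fixes G :: "'a pair_pre_digraph" and k :: nat
  assumes finite_verts: "finite (pverts G)"
    and arc_verts: "(u, v) \<in> parcs G \<Longrightarrow> u \<in> pverts G \<and> v \<in> pverts G"
begin

abbreviation N where "N \<equiv> pverts G"

definition X :: "('a \<Rightarrow> nat) set" where
  "X = {w \<in> numberings N. w \<in> colorings G \<and> asc G w = k}"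

text \<open>The numbering \<open>ref w\<close> is a linear extension, chosen once for each orientation, of the acyclic
  orientation induced by \<open>w\<close>; using it in reverse as a labelling puts a descent of \<open>w\<close> between any two
  adjacent vertices.\<close>

definition ref :: "('a \<Rightarrow> nat) \<Rightarrow> 'a \<Rightarrow> nat" where
  "ref w = (SOME y. y \<in> X \<and> asc_arcs G y = asc_arcs G w)"

definition D :: "('a \<Rightarrow> nat) \<Rightarrow> nat set" where
  "D w = descents N (ref w) w"

text \<open>The reference varies with \<open>w\<close>, but the comparisons that matter stay within
  one orientation: for \<open>w\<close> and \<open>x\<close> in \<open>X\<close>,
  \<open>e w x \<noteq> 0\<close> forces \<open>ref x = ref w\<close>.\<close>

definition R :: "('a \<Rightarrow> nat) \<Rightarrow> nat" where
  "R w = weight N (ref w) w"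

definition e :: "('a \<Rightarrow> nat) \<Rightarrow> ('a \<Rightarrow> nat) \<Rightarrow> complex" where
  "e w x = of_bool (level_eq N (D w) w x)"

text \<open>Constant on the classes at \<open>S\<close> and supported on the separated ones. For
  \<open>S\<close> the levels of a suitable monomial, \<open>collapse\<close> identifies the
  separated classes with colorings.\<close>

definition V :: "nat set \<Rightarrow> (('a \<Rightarrow> nat) \<Rightarrow> complex) set" where
  "V S = {\<phi>. \<forall>w\<in>X. (\<not> separated G S w \<longrightarrow> \<phi> w = 0) \<and>
     (\<forall>w'\<in>X. level_eq N S w w' \<longrightarrow> \<phi> w = \<phi> w')}"

definition act :: "('a \<Rightarrow> 'a) \<Rightarrow> ('a \<Rightarrow> nat) \<Rightarrow> 'a \<Rightarrow> nat" where
  "act g w = compose N w g"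

lemma XD:
  assumes "w \<in> X"
  shows "w \<in> numberings N" "w \<in> colorings G" "asc G w = k"
  using assms by (auto simp: X_def)

lemma finite_X: "finite X"
  using finite_numberings[OF finite_verts] by (rule finite_subset[rotated]) (auto simp: X_def)

lemma ref:
  assumes "w \<in> X"
  shows "ref w \<in> X" "asc_arcs G (ref w) = asc_arcs G w"
  using someI[of "\<lambda>y. y \<in> X \<and> asc_arcs G y = asc_arcs G w" w] assms unfolding ref_def by auto

lemma ref_cong: "asc_arcs G w = asc_arcs G w' \<Longrightarrow> ref w = ref w'"
  by (simp add: ref_def)

lemma inj_ref: "w \<in> X \<Longrightarrow> inj_on (ref w) N"
  using ref(1) XD(1) numberingsD(3) by blast

lemma separated_arc:
  assumes "separated G S w" "level_eq N S w w'" "(u, v) \<in> parcs G"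
  shows "w u < w v \<longleftrightarrow> w' u < w' v" "w' u \<noteq> w' v" "w v < w u \<longleftrightarrow> w' v < w' u"
proof -
  obtain d where d: "d \<in> S" "(w u \<le> d) \<noteq> (w v \<le> d)"
    using assms(1,3) unfolding separated_def by blast
  have "w u \<le> d \<longleftrightarrow> w' u \<le> d" "w v \<le> d \<longleftrightarrow> w' v \<le> d"
    using level_eqD[OF assms(2) d(1)] arc_verts[OF assms(3)] by blast+
  with d(2) show "w u < w v \<longleftrightarrow> w' u < w' v" "w' u \<noteq> w' v" "w v < w u \<longleftrightarrow> w' v < w' u" by auto
qed

lemma separated_level_eq:
  assumes "separated G S w" "level_eq N S w w'"
  shows "separated G S w'"
  unfolding separated_def
proof (clarify)
  fix u v assume uv: "(u, v) \<in> parcs G"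
  then obtain d where d: "d \<in> S" "(w u \<le> d) \<noteq> (w v \<le> d)"
    using assms(1) unfolding separated_def by blast
  then show "\<exists>d\<in>S. (w' u \<le> d) \<noteq> (w' v \<le> d)"
    using level_eqD[OF assms(2) d(1)] arc_verts[OF uv] by blast
qed

lemma separated_mono: "separated G S w \<Longrightarrow> S \<subseteq> T \<Longrightarrow> separated G T w"
  unfolding separated_def by blast

text \<open>In a separated class the lower sets at \<open>S\<close> already fix the order of the two
  ends of every arc, so the whole class shares one orientation.\<close>

lemma X_level_eq:
  assumes "w \<in> X" "separated G S w" "w' \<in> numberings N" "level_eq N S w w'"
  shows "w' \<in> X" "asc_arcs G w' = asc_arcs G w"
proof -
  show asc: "asc_arcs G w' = asc_arcs G w"
    by (rule asc_arcs_cong) (use separated_arc(3)[OF assms(2,4)] in blast)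
  have "w' \<in> colorings G"
    by (rule numbering_in_colorings[OF assms(3)]) (rule separated_arc(2)[OF assms(2,4)])
  then show "w' \<in> X" using assms(3) XD(3)[OF assms(1)] by (simp add: X_def asc_eq_card asc)
qed

text \<open>With no descent between the ends of an arc, \<open>w\<close> and \<open>ref w\<close>
  would order them oppositely, although both induce the same orientation.\<close>

lemma separated_D:
  assumes w: "w \<in> X"
  shows "separated G (D w) w"
  unfolding separated_def
proof (clarify)
  fix u v assume uv: "(u, v) \<in> parcs G"
  have N: "u \<in> N" "v \<in> N" using arc_verts[OF uv] by auto
  note wn = XD(1)[OF w] and y = inj_ref[OF w]
  have ne: "w u \<noteq> w v" "ref w u \<noteq> ref w v"
    using coloringsD(3)[OF XD(2)[OF w] uv] coloringsD(3)[OF XD(2)[OF ref(1)[OF w]] uv] by auto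
  have asc: "w u > w v \<longleftrightarrow> ref w u > ref w v"
    using ref(2)[OF w] uv unfolding asc_arcs_def by blast
  show "\<exists>d\<in>D w. (w u \<le> d) \<noteq> (w v \<le> d)"
  proof (rule ccontr)
    assume "\<not> ?thesis"
    then have no: "\<And>d. d \<in> descents N (ref w) w \<Longrightarrow> w u \<le> d \<longleftrightarrow> w v \<le> d" unfolding D_def by blast
    show False
    proof (cases "w u < w v")
      case True
      have "ref w v < ref w u" by (rule reversed_between_descents[OF wn y N True]) (use no in blast)
      then show False using asc True by simp
    next
      case False
      then have less: "w v < w u" using ne by simp
      have "ref w u < ref w v" by (rule reversed_between_descents[OF wn y N(2,1) less]) (use no in blast)
      then show False using asc less by simp
    qed
  qed
qed

lemma act_in_X:
  assumes g: "g \<in> digraph_aut G" and w: "w \<in> X"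
  shows "act g w \<in> X"
proof -
  note gD = digraph_autD[OF g]
  have val: "act g w v = w (g v)" if "v \<in> N" for v
    using compose_digraph_aut(1)[OF g that] by (simp add: act_def)
  have "bij_betw (compose N w g) N {1..card N}"
    by (rule bij_betw_compose[OF _ numberingsD(2)[OF XD(1)[OF w]]]) (use gD(3,4) in \<open>simp add: bij_betw_def\<close>)
  then have num: "act g w \<in> numberings N" by (simp add: numberings_def act_def)
  have "act g w u \<noteq> act g w v" if uv: "(u, v) \<in> parcs G" for u v
  proof -
    have "u \<in> N" "v \<in> N" using arc_verts[OF uv] by auto
    then show ?thesis using gD(5)[of u v] uv coloringsD(3)[OF XD(2)[OF w], of "g u" "g v"] by (simp add: val)
  qed
  then have col: "act g w \<in> colorings G" by (rule numbering_in_colorings[OF num])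
  have "bij_betw (map_prod g g) (asc_arcs G (act g w)) (asc_arcs G w)"
    unfolding bij_betw_def
  proof (intro conjI equalityI subsetI)
    show "inj_on (map_prod g g) (asc_arcs G (act g w))"
    proof (rule inj_on_subset)
      show "inj_on (map_prod g g) (N \<times> N)" using gD(3) by (rule map_prod_inj_on[OF _ gD(3)])
      show "asc_arcs G (act g w) \<subseteq> N \<times> N" using arc_verts by (auto simp: asc_arcs_def)
    qed
  next
    fix p assume "p \<in> map_prod g g ` asc_arcs G (act g w)"
    then obtain u v where uv: "p = (g u, g v)" "(u, v) \<in> parcs G" "act g w u > act g w v"
      unfolding asc_arcs_def by auto
    have "u \<in> N" "v \<in> N" using arc_verts[OF uv(2)] by auto
    then show "p \<in> asc_arcs G w" using uv gD(5)[of u v] by (simp add: asc_arcs_def val)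
  next
    fix p assume "p \<in> asc_arcs G w"
    then obtain a b where ab: "p = (a, b)" "(a, b) \<in> parcs G" "w a > w b" unfolding asc_arcs_def by auto
    have "a \<in> g ` N" "b \<in> g ` N" using arc_verts[OF ab(2)] gD(4) by auto
    then obtain u v where uv: "u \<in> N" "v \<in> N" "a = g u" "b = g v" by blast
    then have "(u, v) \<in> asc_arcs G (act g w)"
      using ab gD(5)[of u v] by (simp add: asc_arcs_def val)
    then show "p \<in> map_prod g g ` asc_arcs G (act g w)" using ab uv by force
  qed
  then have "asc G (act g w) = k"
    using bij_betw_same_card XD(3)[OF w] unfolding asc_eq_card by metis
  then show ?thesis using num col by (simp add: X_def)
qed

lemma level_eq_act:
  assumes g: "g \<in> digraph_aut G" and "level_eq N S w w'"
  shows "level_eq N S (act g w) (act g w')"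
  using assms(2) unfolding level_eq_def act_def by (simp add: compose_digraph_aut[OF g])

lemma separated_act:
  assumes g: "g \<in> digraph_aut G" and s: "separated G S (act g w)"
  shows "separated G S w"
  unfolding separated_def
proof (clarify)
  fix a b assume ab: "(a, b) \<in> parcs G"
  note gD = digraph_autD[OF g]
  have "a \<in> g ` N" "b \<in> g ` N" using arc_verts[OF ab] gD(4) by auto
  then obtain u v where uv: "u \<in> N" "v \<in> N" "a = g u" "b = g v" by blast
  then have "(u, v) \<in> parcs G" using ab gD(5)[of u v] by simp
  then obtain d where "d \<in> S" "(act g w u \<le> d) \<noteq> (act g w v \<le> d)"
    using s unfolding separated_def by blast
  then show "\<exists>d\<in>S. (w a \<le> d) \<noteq> (w b \<le> d)"
    using uv unfolding act_def by (auto simp: compose_digraph_aut(1)[OF g])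
qed

lemma VI:
  assumes "\<And>w. w \<in> X \<Longrightarrow> \<not> separated G S w \<Longrightarrow> \<phi> w = 0"
    and "\<And>w w'. w \<in> X \<Longrightarrow> w' \<in> X \<Longrightarrow> level_eq N S w w' \<Longrightarrow> \<phi> w = \<phi> w'"
  shows "\<phi> \<in> V S"
  using assms unfolding V_def by blast

lemma VD:
  assumes "\<phi> \<in> V S" "w \<in> X"
  shows "\<not> separated G S w \<Longrightarrow> \<phi> w = 0" "w' \<in> X \<Longrightarrow> level_eq N S w w' \<Longrightarrow> \<phi> w = \<phi> w'"
  using assms unfolding V_def by blast+

lemma triangular_action:
  assumes H: "H \<subseteq> digraph_aut G"
    and carrier: "carrier \<G> = H" and one: "\<one>\<^bsub>\<G>\<^esub> = (\<lambda>x\<in>N. x)"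
    and mult: "\<And>g h. g \<in> H \<Longrightarrow> h \<in> H \<Longrightarrow> g \<otimes>\<^bsub>\<G>\<^esub> h = compose N g h"
  shows "triangular_action X R e \<G> act D V"
proof unfold_locales
  show "finite X" by (rule finite_X)
  show "e w w = 1" if "w \<in> X" for w by (simp add: e_def level_eq_refl)
  show "x = w \<or> R w < R x" if w: "w \<in> X" and x: "x \<in> X" and "e w x \<noteq> 0" for w x
  proof -
    have eq: "level_eq N (D w) w x" using that(3) by (simp add: e_def split: if_splits)
    \<comment> \<open>The support of \<open>e w\<close> stays inside one orientation, so both
      weights use the same reference.\<close>
    have "ref x = ref w"
      by (rule ref_cong, rule X_level_eq(2)[OF w separated_D[OF w] XD(1)[OF x] eq])
    then show ?thesis
      using numbering_weight_minimal[OF finite_verts XD(1)[OF w] XD(1)[OF x] inj_ref[OF w] eq]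
      by (simp add: R_def D_def)
  qed
  show "act g x \<in> X" if "g \<in> carrier \<G>" "x \<in> X" for g x
    using act_in_X that H carrier by blast
  show "act \<one>\<^bsub>\<G>\<^esub> x = x" if "x \<in> X" for x
    unfolding act_def one using numberingsD(1)[OF XD(1)[OF that]]
    by (intro extensionalityI[of _ N]) (auto simp: compose_def)
  show "act (g \<otimes>\<^bsub>\<G>\<^esub> h) x = act h (act g x)"
    if "g \<in> carrier \<G>" "h \<in> carrier \<G>" "x \<in> X" for g h x
  proof -
    have gh: "g \<in> H" "h \<in> H" using that carrier by auto
    have "h \<in> digraph_aut G" using gh H by blast
    note h = compose_digraph_aut(2)[OF this]
    show ?thesis
      unfolding act_def mult[OF gh] by (intro extensionalityI[of _ N]) (auto simp: compose_def h)
  qed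
  show "subspace_on X (V S)" for S
    unfolding subspace_on_def
  proof (intro conjI ballI allI impI)
    show "(\<lambda>_. 0) \<in> V S" by (rule VI) auto
    show "(\<lambda>i. \<phi> i + c * \<psi> i) \<in> V S" if "\<phi> \<in> V S" "\<psi> \<in> V S" for \<phi> \<psi> c
    proof (rule VI)
      show "\<phi> w + c * \<psi> w = 0" if "w \<in> X" "\<not> separated G S w" for w
        using VD(1)[OF \<open>\<phi> \<in> V S\<close> that] VD(1)[OF \<open>\<psi> \<in> V S\<close> that] by simp
      show "\<phi> w + c * \<psi> w = \<phi> w' + c * \<psi> w'" if "w \<in> X" "w' \<in> X" "level_eq N S w w'" for w w'
        using VD(2)[OF \<open>\<phi> \<in> V S\<close> that] VD(2)[OF \<open>\<psi> \<in> V S\<close> that] by simp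
    qed
    show "\<psi> \<in> V S" if "\<phi> \<in> V S" "\<forall>i\<in>X. \<psi> i = \<phi> i" for \<phi> \<psi>
    proof (rule VI)
      show "\<psi> w = 0" if "w \<in> X" "\<not> separated G S w" for w
        using VD(1)[OF \<open>\<phi> \<in> V S\<close> that] that(1) \<open>\<forall>i\<in>X. \<psi> i = \<phi> i\<close> by simp
      show "\<psi> w = \<psi> w'" if "w \<in> X" "w' \<in> X" "level_eq N S w w'" for w w'
        using VD(2)[OF \<open>\<phi> \<in> V S\<close> that] that(1,2) \<open>\<forall>i\<in>X. \<psi> i = \<phi> i\<close> by simp
    qed
  qed
  show "(\<lambda>x. \<phi> (act g x)) \<in> V S" if "g \<in> carrier \<G>" "\<phi> \<in> V S" for g \<phi> S
  proof (rule VI)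
    have g: "g \<in> digraph_aut G" using that(1) H carrier by blast
    show "\<phi> (act g w) = 0" if "w \<in> X" "\<not> separated G S w" for w
      using VD(1)[OF \<open>\<phi> \<in> V S\<close> act_in_X[OF g that(1)]] separated_act[OF g] that(2) by blast
    show "\<phi> (act g w) = \<phi> (act g w')" if "w \<in> X" "w' \<in> X" "level_eq N S w w'" for w w'
      by (intro VD(2)[OF \<open>\<phi> \<in> V S\<close>] act_in_X[OF g] level_eq_act[OF g] that)
  qed
  show "e w \<in> V S" if w: "w \<in> X" and S: "D w \<subseteq> S" for w S
  proof (rule VI)
    show "e w x = 0" if "x \<in> X" "\<not> separated G S x" for x
    proof -
      have "\<not> level_eq N (D w) w x"
        using separated_mono[OF separated_level_eq[OF separated_D[OF w]] S] that(2) by blast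
      then show ?thesis by (simp add: e_def)
    qed
    show "e w x = e w x'" if "level_eq N S x x'" for x x'
    proof -
      have "level_eq N (D w) x x'" by (rule level_eq_mono[OF that S])
      then have "level_eq N (D w) w x \<longleftrightarrow> level_eq N (D w) w x'"
        using level_eq_trans level_eq_sym by blast
      then show ?thesis by (simp add: e_def)
    qed
  qed
  show "D w \<subseteq> S" if \<phi>: "\<phi> \<in> V S" and w: "w \<in> X" and nz: "\<phi> w \<noteq> 0"
    and least: "\<forall>x\<in>X. R x < R w \<longrightarrow> \<phi> x = 0" for \<phi> w S
  proof (rule ccontr)
    assume "\<not> D w \<subseteq> S"
    then obtain i where i: "i \<in> descents N (ref w) w" "i \<notin> S" by (auto simp: D_def)
    \<comment> \<open>The exchange at \<open>i\<close> yields a numbering of lower rank in the same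
      class at \<open>S\<close>, where \<open>\<phi>\<close> has the same nonzero value, against
      \<open>least\<close>.\<close>
    obtain w' where w': "w' \<in> numberings N" "level_eq N S w w'" "weight N (ref w) w' < weight N (ref w) w"
      using numbering_swap[OF finite_verts XD(1)[OF w] i] by blast
    have "separated G S w" using VD(1)[OF \<phi> w] nz by blast
    note w'X = X_level_eq[OF w this w'(1,2)]
    have "R w' < R w" using w'(3) ref_cong[OF w'X(2)] by (simp add: R_def)
    then have "\<phi> w' = 0" using least w'X(1) by blast
    then show False using VD(2)[OF \<phi> w w'X(1) w'(2)] nz by simp
  qed
qed

end

section \<open>Colorings with a given monomial\<close>

lemma monomial_level_0 [simp]: "monomial_level m 0 = 0"
  by (simp add: monomial_level_def)

lemma monomial_level_Suc: "monomial_level m (Suc j) = monomial_level m j + Poly_Mapping.lookup m j"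
  by (simp add: monomial_level_def)

lemma monomial_level_mono: "i \<le> j \<Longrightarrow> monomial_level m i \<le> monomial_level m j"
  unfolding monomial_level_def by (intro sum_mono2) auto

lemma monomial_level_top:
  assumes "Poly_Mapping.keys m \<subseteq> {..<j}"
  shows "monomial_level m j = monomial_degree m"
  unfolding monomial_level_def monomial_degree_def using assms
  by (intro sum.mono_neutral_right) (auto simp: in_keys_iff)

lemma ex_monomial_level_top: "\<exists>j. monomial_level m (Suc j) = monomial_degree m"
proof -
  obtain j where "Poly_Mapping.keys m \<subseteq> {..j}"
    using finite_nat_iff_bounded_le[of "Poly_Mapping.keys m"] by auto
  then have "Poly_Mapping.keys m \<subseteq> {..<Suc j}" by (auto simp: lessThan_Suc_atMost)
  then show ?thesis using monomial_level_top by blast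
qed

lemma monomial_level_le_degree: "monomial_level m j \<le> monomial_degree m"
proof -
  obtain i where i: "monomial_level m (Suc i) = monomial_degree m" using ex_monomial_level_top by blast
  show ?thesis
  proof (cases "j \<le> Suc i")
    case True
    then show ?thesis using monomial_level_mono[OF True, of m] i by simp
  next
    case False
    show ?thesis unfolding monomial_level_def monomial_degree_def
      by (subst sum.mono_neutral_right[of "{..<j}" "Poly_Mapping.keys m \<inter> {..<j}"])
        (auto simp: in_keys_iff intro!: sum_mono2)
  qed
qed

text \<open>List the variables of \<open>m\<close> in increasing order with multiplicity; for
  \<open>p\<close> from 1 up to the degree, this is the entry at position \<open>p\<close>.
  \<open>Suc j\<close> appears because \<open>monomial_level m j\<close> stops before variable
  \<open>j\<close>.\<close>

definition level_of :: "monomial \<Rightarrow> nat \<Rightarrow> nat" where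
  "level_of m p = (LEAST j. p \<le> monomial_level m (Suc j))"

lemma level_of_le_iff:
  assumes "p \<le> monomial_degree m"
  shows "level_of m p \<le> j \<longleftrightarrow> p \<le> monomial_level m (Suc j)"
proof
  obtain i where "p \<le> monomial_level m (Suc i)" using ex_monomial_level_top[of m] assms by metis
  then have "p \<le> monomial_level m (Suc (level_of m p))" unfolding level_of_def by (rule LeastI)
  then show "p \<le> monomial_level m (Suc j)" if "level_of m p \<le> j"
    using monomial_level_mono[of "Suc (level_of m p)" "Suc j" m] that by simp
  show "level_of m p \<le> j" if "p \<le> monomial_level m (Suc j)"
    unfolding level_of_def using that by (rule Least_le)
qed

lemma level_of_eq_iff:
  assumes "1 \<le> p" "p \<le> monomial_degree m"
  shows "level_of m p = j \<longleftrightarrow> monomial_level m j < p \<and> p \<le> monomial_level m (Suc j)"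
proof (cases j)
  \<comment> \<open>At \<open>j = 0\<close> the strict lower bound reads \<open>0 < p\<close>, which
    holds since positions are counted from 1.\<close>
  case 0
  then show ?thesis using level_of_le_iff[OF assms(2), of 0] assms(1) by simp
next
  case (Suc i)
  then show ?thesis
    using level_of_le_iff[OF assms(2), of i] level_of_le_iff[OF assms(2), of j] by auto
qed

text \<open>Forgets the order inside each block, sending a numbering that refines a coloring back to
  that coloring.\<close>

definition collapse :: "'a set \<Rightarrow> monomial \<Rightarrow> ('a \<Rightarrow> nat) \<Rightarrow> 'a \<Rightarrow> nat" where
  "collapse N m w = restrict (\<lambda>v. level_of m (w v)) N"

lemma collapse_apply: "v \<in> N \<Longrightarrow> collapse N m w v = level_of m (w v)"
  by (simp add: collapse_def)

lemma lookup_color_monomial: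
  assumes "finite (pverts G)"
  shows "Poly_Mapping.lookup (color_monomial G f) j = card {v \<in> pverts G. f v = j}"
proof -
  have "Poly_Mapping.lookup (color_monomial G f) j = (\<Sum>v\<in>pverts G. if f v = j then 1 else 0)"
    unfolding color_monomial_def lookup_sum by (intro sum.cong refl) (simp add: lookup_single when_def)
  also have "\<dots> = card {v \<in> pverts G. f v = j}"
    using assms by (simp add: sum.If_cases Int_def)
  finally show ?thesis .
qed

lemma monomial_level_color_monomial:
  assumes "finite (pverts G)"
  shows "monomial_level (color_monomial G f) j = card {v \<in> pverts G. f v < j}"
proof (induction j)
  case (Suc j)
  have "{v \<in> pverts G. f v < Suc j} = {v \<in> pverts G. f v < j} \<union> {v \<in> pverts G. f v = j}" by auto
  moreover have "card ({v \<in> pverts G. f v < j} \<union> {v \<in> pverts G. f v = j}) =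
      card {v \<in> pverts G. f v < j} + card {v \<in> pverts G. f v = j}"
    using assms by (intro card_Un_disjoint) auto
  ultimately show ?case
    by (simp add: monomial_level_Suc Suc.IH lookup_color_monomial[OF assms])
qed simp

lemma color_monomial_degree:
  assumes "finite (pverts G)"
  shows "monomial_degree (color_monomial G f) = card (pverts G)"
proof -
  let ?m = "color_monomial G f"
  have sub: "v \<in> pverts G \<Longrightarrow> f v \<in> Poly_Mapping.keys ?m" for v
    using assms by (auto simp: in_keys_iff lookup_color_monomial)
  obtain j where j: "Poly_Mapping.keys ?m \<subseteq> {..<j}"
    using finite_nat_iff_bounded[of "Poly_Mapping.keys ?m"] by auto
  have "{v \<in> pverts G. f v < j} = pverts G" using sub j by auto
  then show ?thesis using monomial_level_top[OF j] monomial_level_color_monomial[OF assms, of f j] by simp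
qed

context digraph_numberings
begin

definition Y :: "monomial \<Rightarrow> ('a \<Rightarrow> nat) set" where
  "Y m = {f \<in> colorings G. color_monomial G f = m \<and> asc G f = k}"

lemma Y_monomial:
  assumes "f \<in> Y m"
  shows "0 \<notin> Poly_Mapping.keys m" "monomial_degree m = card N"
proof -
  have f: "f \<in> colorings G" and m: "m = color_monomial G f" using assms by (auto simp: Y_def)
  have "{v \<in> N. f v = 0} = {}" using coloringsD(2)[OF f] by force
  then have "card {v \<in> N. f v = 0} = 0" by (simp only: card.empty)
  then show "0 \<notin> Poly_Mapping.keys m"
    unfolding m in_keys_iff lookup_color_monomial[OF finite_verts] by (simp only: not_not)
  show "monomial_degree m = card N" unfolding m by (rule color_monomial_degree[OF finite_verts])
qed

lemma finite_colorings_monomial: "finite {f \<in> colorings G. color_monomial G f = m}"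
proof (rule finite_subset)
  show "finite (N \<rightarrow>\<^sub>E Poly_Mapping.keys m)" using finite_verts by (simp add: finite_PiE)
  show "{f \<in> colorings G. color_monomial G f = m} \<subseteq> N \<rightarrow>\<^sub>E Poly_Mapping.keys m"
  proof
    fix f assume "f \<in> {f \<in> colorings G. color_monomial G f = m}"
    then have f: "f \<in> colorings G" "color_monomial G f = m" by auto
    have "f v \<in> Poly_Mapping.keys m" if "v \<in> N" for v
      unfolding f(2)[symmetric] using that finite_verts
      by (auto simp: in_keys_iff lookup_color_monomial)
    then show "f \<in> N \<rightarrow>\<^sub>E Poly_Mapping.keys m" using coloringsD(1)[OF f(1)] by (simp add: PiE_def)
  qed
qed

lemma finite_Y: "finite (Y m)"
  using finite_colorings_monomial[of m] by (rule finite_subset[rotated]) (auto simp: Y_def)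

lemma t_coeff_chromatic:
  "t_coeff k (chromatic G) g m = of_nat (card {f \<in> Y m. compose N f g = f})"
proof -
  let ?A = "{f. f \<in> colorings G \<and> compose N f g = f \<and> color_monomial G f = m}"
  have fA: "finite ?A" using finite_colorings_monomial[of m] by (rule finite_subset[rotated]) auto
  have "t_coeff k (chromatic G) g m = (\<Sum>f\<in>?A. if asc G f = k then 1 else 0)"
    unfolding t_coeff_def chromatic_def coeff_sum by (intro sum.cong) (auto simp: coeff_monom)
  also have "\<dots> = of_nat (card (?A \<inter> {f. asc G f = k}))" using fA by (simp add: sum.If_cases)
  also have "?A \<inter> {f. asc G f = k} = {f \<in> Y m. compose N f g = f}" by (auto simp: Y_def)
  finally show ?thesis .
qed

section \<open>Colorings with a fixed monomial as classes of numberings\<close>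

context
  fixes m :: monomial
  assumes m0: "0 \<notin> Poly_Mapping.keys m" and degree: "monomial_degree m = card N"
begin

abbreviation S where "S \<equiv> range (monomial_level m)"

lemma level_of_numbering:
  assumes "w \<in> numberings N" "v \<in> N"
  shows "level_of m (w v) \<le> j \<longleftrightarrow> w v \<le> monomial_level m (Suc j)"
    and "level_of m (w v) = j \<longleftrightarrow> monomial_level m j < w v \<and> w v \<le> monomial_level m (Suc j)"
  using level_of_le_iff[of "w v" m j] level_of_eq_iff[of "w v" m j] numberingsD(5)[OF assms] degree
  by auto

text \<open>A colour at most \<open>j\<close> means a position at most
  \<open>monomial_level m (Suc j)\<close>, so equal colours amount to equal lower sets. The
  remaining level 0 tells nothing apart because positions start at 1.\<close>

lemma collapse_eq_iff:
  assumes w: "w \<in> numberings N" and w': "w' \<in> numberings N"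
  shows "collapse N m w = collapse N m w' \<longleftrightarrow> level_eq N S w w'"
proof
  assume eq: "collapse N m w = collapse N m w'"
  show "level_eq N S w w'" unfolding level_eq_def
  proof (intro ballI)
    fix d v assume "d \<in> S" and v: "v \<in> N"
    then obtain j where d: "d = monomial_level m j" by blast
    have "level_of m (w v) = level_of m (w' v)"
      using fun_cong[OF eq, of v] v by (simp add: collapse_apply)
    then show "w v \<le> d \<longleftrightarrow> w' v \<le> d"
      using level_of_numbering(1)[OF w v] level_of_numbering(1)[OF w' v]
        numberingsD(5)[OF w v] numberingsD(5)[OF w' v]
      unfolding d by (cases j) auto
  qed
next
  assume eq: "level_eq N S w w'"
  have "level_of m (w v) = level_of m (w' v)" if v: "v \<in> N" for v
  proof (rule antisym)
    have *: "level_of m (w v) \<le> j \<longleftrightarrow> level_of m (w' v) \<le> j" for j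
      using level_of_numbering(1)[OF w v] level_of_numbering(1)[OF w' v]
        level_eqD[OF eq, of "monomial_level m (Suc j)" v] v by blast
    show "level_of m (w v) \<le> level_of m (w' v)" "level_of m (w' v) \<le> level_of m (w v)"
      using * by blast+
  qed
  then show "collapse N m w = collapse N m w'" unfolding collapse_def by (rule restrict_ext)
qed

lemma color_monomial_collapse:
  assumes w: "w \<in> numberings N"
  shows "color_monomial G (collapse N m w) = m"
proof (rule poly_mapping_eqI)
  fix j
  have "{v \<in> N. collapse N m w v = j} = {v \<in> N. w v \<in> {monomial_level m j<..monomial_level m (Suc j)}}"
    by (simp add: collapse_apply level_of_numbering(2)[OF w] cong: conj_cong)
  moreover have "w ` {v \<in> N. w v \<in> {monomial_level m j<..monomial_level m (Suc j)}} =
      {monomial_level m j<..monomial_level m (Suc j)}"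
  proof -
    have "{monomial_level m j<..monomial_level m (Suc j)} \<subseteq> w ` N"
      unfolding numberingsD(4)[OF w] using monomial_level_le_degree[of m "Suc j"] degree by auto
    then show ?thesis by blast
  qed
  moreover have "inj_on w {v \<in> N. w v \<in> {monomial_level m j<..monomial_level m (Suc j)}}"
    using numberingsD(3)[OF w] by (rule inj_on_subset) auto
  ultimately have "card {v \<in> N. collapse N m w v = j} =
      card {monomial_level m j<..monomial_level m (Suc j)}"
    using card_image by metis
  then show "Poly_Mapping.lookup (color_monomial G (collapse N m w)) j = Poly_Mapping.lookup m j"
    unfolding lookup_color_monomial[OF finite_verts] by (simp add: monomial_level_Suc)
qed

text \<open>Collapsing is weakly monotone, so as soon as the ends of every arc get different
  colours, each arc keeps its direction and the number of ascents survives.\<close>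

lemma collapse_in_Y_iff:
  assumes w: "w \<in> X"
  shows "collapse N m w \<in> Y m \<longleftrightarrow> separated G S w"
proof
  note wn = XD(1)[OF w]
  assume "collapse N m w \<in> Y m"
  then have col: "collapse N m w \<in> colorings G" by (simp add: Y_def)
  show "separated G S w" unfolding separated_def
  proof (clarify)
    fix u v assume uv: "(u, v) \<in> parcs G"
    have N: "u \<in> N" "v \<in> N" using arc_verts[OF uv] by auto
    have "level_of m (w u) \<noteq> level_of m (w v)"
      using coloringsD(3)[OF col uv] N by (simp add: collapse_apply)
    then consider "level_of m (w u) \<le> level_of m (w u)" "\<not> level_of m (w v) \<le> level_of m (w u)"
      | "level_of m (w v) \<le> level_of m (w v)" "\<not> level_of m (w u) \<le> level_of m (w v)" by linarith
    then show "\<exists>d\<in>S. (w u \<le> d) \<noteq> (w v \<le> d)"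
      unfolding level_of_numbering(1)[OF wn N(1)] level_of_numbering(1)[OF wn N(2)] by cases blast+
  qed
next
  note wn = XD(1)[OF w]
  assume sep: "separated G S w"
  have ne: "level_of m (w u) \<noteq> level_of m (w v)" if uv: "(u, v) \<in> parcs G" for u v
  proof
    assume eq: "level_of m (w u) = level_of m (w v)"
    have N: "u \<in> N" "v \<in> N" using arc_verts[OF uv] by auto
    obtain j where j: "(w u \<le> monomial_level m j) \<noteq> (w v \<le> monomial_level m j)"
      using sep uv unfolding separated_def by blast
    \<comment> \<open>Level 0 lies below all positions, so it cannot separate the two ends.\<close>
    obtain i where "j = Suc i"
      using j numberingsD(5)[OF wn N(1)] numberingsD(5)[OF wn N(2)] by (cases j) auto
    then show False
      using j eq level_of_numbering(1)[OF wn N(1), of i] level_of_numbering(1)[OF wn N(2), of i] by simp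
  qed
  have "asc_arcs G (collapse N m w) = asc_arcs G w"
  proof (rule asc_arcs_cong)
    fix u v assume uv: "(u, v) \<in> parcs G"
    have N: "u \<in> N" "v \<in> N" using arc_verts[OF uv] by auto
    have mono: "level_of m (w a) \<le> level_of m (w b)" if "w a \<le> w b" "a \<in> N" "b \<in> N" for a b
      using level_of_numbering(1)[OF wn that(2), of "level_of m (w b)"]
        level_of_numbering(1)[OF wn that(3), of "level_of m (w b)"] that(1) by auto
    show "collapse N m w v < collapse N m w u \<longleftrightarrow> w v < w u"
    proof (cases "w u \<le> w v")
      case True
      then show ?thesis using mono[OF True N] N by (simp add: collapse_apply)
    next
      case False
      then show ?thesis using mono[of v u] ne[OF uv] N by (simp add: collapse_apply)
    qed
  qed
  then have "asc G (collapse N m w) = k" using XD(3)[OF w] by (simp add: asc_eq_card)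
  moreover have "collapse N m w \<in> colorings G"
  proof -
    \<comment> \<open>A vertex of colour 0 would have a position bounded by the exponent of variable
      0, which is 0 by \<open>m0\<close>.\<close>
    have "1 \<le> level_of m (w v)" if v: "v \<in> N" for v
    proof (rule ccontr)
      assume "\<not> ?thesis"
      then have "level_of m (w v) = 0" by simp
      then have "w v \<le> Poly_Mapping.lookup m 0"
        using level_of_numbering(2)[OF wn v, of 0] by (simp add: monomial_level_Suc)
      then show False using m0 numberingsD(5)[OF wn v] by (simp add: in_keys_iff)
    qed
    moreover have "collapse N m w u \<noteq> collapse N m w v" if "(u, v) \<in> parcs G" for u v
      using ne[OF that] arc_verts[OF that] by (simp add: collapse_apply)
    ultimately show ?thesis unfolding colorings_def by (auto simp: collapse_apply) (simp add: collapse_def)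
  qed
  ultimately show "collapse N m w \<in> Y m"
    using color_monomial_collapse[OF wn] by (simp add: Y_def)
qed

lemma ex_collapse:
  assumes f: "f \<in> Y m"
  shows "\<exists>w\<in>X. collapse N m w = f"
proof -
  have fc: "f \<in> colorings G" and fm: "color_monomial G f = m" and fk: "asc G f = k"
    using f by (auto simp: Y_def)
  obtain b where b: "inj_on b N" "b ` N = {0..<card N}"
    using ex_bij_betw_finite_nat[OF finite_verts] unfolding bij_betw_def by blast
  \<comment> \<open>Lexicographic order with colour first: the factor \<open>card N\<close> exceeds
    every tie-breaker \<open>b v\<close>.\<close>
  define key where "key v = f v * card N + b v" for v
  have less: "key u < key v" if "f u < f v" "u \<in> N" "v \<in> N" for u v
  proof -
    have "b u < card N" using b(2) that(2) by auto
    then have "key u < Suc (f u) * card N" by (simp add: key_def)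
    also have "\<dots> \<le> f v * card N" using that(1) by (intro mult_right_mono) auto
    finally show ?thesis by (simp add: key_def)
  qed
  have "inj_on key N"
  proof (rule inj_onI)
    fix u v assume uv: "u \<in> N" "v \<in> N" "key u = key v"
    then have "f u = f v" using less[of u v] less[of v u] by (metis less_irrefl linorder_neqE_nat)
    then have "b u = b v" using uv(3) by (simp add: key_def)
    then show "u = v" using b(1) uv by (simp add: inj_on_def)
  qed
  then obtain w where w: "w \<in> numberings N"
    and "\<And>u v. u \<in> N \<Longrightarrow> v \<in> N \<Longrightarrow> key u < key v \<Longrightarrow> w u < w v"
    using ex_numbering[OF finite_verts] by blast
  then have mono: "w u < w v" if "u \<in> N" "v \<in> N" "f u < f v" for u v using less that by blast
  have level: "monomial_level m j = card {v \<in> N. f v < j}" for j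
    unfolding fm[symmetric] by (rule monomial_level_color_monomial[OF finite_verts])
  have "collapse N m w = f"
  proof (rule extensionalityI[of _ N])
    fix v assume v: "v \<in> N"
    \<comment> \<open>The position of \<open>v\<close> exceeds the number of vertices of smaller
      colour and is at most the number of those of colour up to \<open>f v\<close>; these bounds
      delimit the block of colour \<open>f v\<close>.\<close>
    have "card {u \<in> N. f u < f v} < card {u \<in> N. w u \<le> w v}"
    proof (rule psubset_card_mono)
      have "{u \<in> N. f u < f v} \<subseteq> {u \<in> N. w u \<le> w v}" using mono v by (auto intro: less_imp_le)
      then show "{u \<in> N. f u < f v} \<subset> {u \<in> N. w u \<le> w v}" using v by blast
    qed (use finite_verts in simp)
    moreover have "card {u \<in> N. w u \<le> w v} \<le> card {u \<in> N. f u < Suc (f v)}"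
    proof (rule card_mono)
      have "f u < Suc (f v)" if "u \<in> N" "w u \<le> w v" for u
        using mono[OF v that(1)] that(2) by (metis not_le not_less_eq)
      then show "{u \<in> N. w u \<le> w v} \<subseteq> {u \<in> N. f u < Suc (f v)}" by blast
    qed (use finite_verts in simp)
    ultimately have "level_of m (w v) = f v"
      unfolding level_of_numbering(2)[OF w v] level card_le_numbering[OF w v] by simp
    then show "collapse N m w v = f v" using v by (simp add: collapse_apply)
  qed (use coloringsD(1)[OF fc] in \<open>auto simp: collapse_def\<close>)
  moreover have "w \<in> X"
  proof -
    have N: "u \<in> N" "v \<in> N" if "(u, v) \<in> parcs G" for u v using arc_verts[OF that] by auto
    have order: "w u < w v \<longleftrightarrow> f u < f v" if "(u, v) \<in> parcs G \<or> (v, u) \<in> parcs G" for u v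
    proof -
      have uvN: "u \<in> N" "v \<in> N" "f u \<noteq> f v" using that N coloringsD(3)[OF fc] by metis+
      then show ?thesis using mono[of u v] mono[of v u] by linarith
    qed
    have "w \<in> colorings G"
    proof (rule numbering_in_colorings[OF w])
      fix u v assume uv: "(u, v) \<in> parcs G"
      show "w u \<noteq> w v" using order[of u v] order[of v u] coloringsD(3)[OF fc uv] uv by auto
    qed
    moreover have "asc_arcs G w = asc_arcs G f"
      by (rule asc_arcs_cong) (use order in blast)
    ultimately show ?thesis using w fk by (simp add: X_def asc_eq_card)
  qed
  ultimately show ?thesis by blast
qed

lemma collapse_act:
  assumes g: "g \<in> digraph_aut G"
  shows "collapse N m (act g w) = compose N (collapse N m w) g"
  unfolding act_def collapse_def
  by (rule extensionalityI[of _ N]) (auto simp: compose_def compose_digraph_aut(2)[OF g])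

text \<open>The indicators \<open>b f\<close> of the classes form a basis of \<open>V S\<close> that
  \<open>g\<close> permutes, so the trace counts the colorings fixed by \<open>g\<close>.\<close>

lemma fixed_colorings:
  assumes "triangular_action X R e \<G> act D V" and g: "g \<in> carrier \<G>" "g \<in> digraph_aut G"
  shows "(\<Sum>w | w \<in> X \<and> D w \<subseteq> S. triangular_action.coeff_kernel X e act g w w) =
    of_nat (card {f \<in> Y m. compose N f g = f})"
proof -
  interpret triangular_action X R e \<G> act D V by fact
  define rep where "rep f = (SOME w. w \<in> X \<and> collapse N m w = f)" for f
  have rep: "rep f \<in> X" "collapse N m (rep f) = f" if "f \<in> Y m" for f
  proof -
    have "\<exists>w. w \<in> X \<and> collapse N m w = f" using ex_collapse[OF that] by blast
    from someI_ex[OF this] show "rep f \<in> X" "collapse N m (rep f) = f" unfolding rep_def by auto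
  qed
  define b :: "('a \<Rightarrow> nat) \<Rightarrow> ('a \<Rightarrow> nat) \<Rightarrow> complex"
    where "b f w = of_bool (collapse N m w = f)" for f w
  have "(\<Sum>w | w \<in> X \<and> D w \<subseteq> S. coeff_kernel g w w) = (\<Sum>f\<in>Y m. b f (act g (rep f)))"
  proof (rule trace_V[OF g(1) finite_Y])
    show "rep f \<in> X" if "f \<in> Y m" for f by (rule rep(1)[OF that])
    show "b f \<in> V S" if f: "f \<in> Y m" for f
    proof (rule VI)
      show "b f w = 0" if "w \<in> X" "\<not> separated G S w" for w
        using collapse_in_Y_iff[OF that(1)] that(2) f by (auto simp: b_def)
      show "b f w = b f w'" if "w \<in> X" "w' \<in> X" "level_eq N S w w'" for w w'
        using collapse_eq_iff[OF XD(1)[OF that(1)] XD(1)[OF that(2)]] that(3) by (simp add: b_def)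
    qed
    show "\<phi> w = (\<Sum>f\<in>Y m. \<phi> (rep f) * b f w)" if \<phi>: "\<phi> \<in> V S" and w: "w \<in> X" for \<phi> w
    proof -
      have "(\<Sum>f\<in>Y m. \<phi> (rep f) * b f w) =
          (\<Sum>f\<in>Y m. if collapse N m w = f then \<phi> (rep (collapse N m w)) else 0)"
        by (intro sum.cong) (auto simp: b_def)
      also have "\<dots> = (if collapse N m w \<in> Y m then \<phi> (rep (collapse N m w)) else 0)"
        using finite_Y by simp
      also have "\<dots> = \<phi> w"
      proof (cases "collapse N m w \<in> Y m")
        case True
        note r = rep[OF True]
        have "level_eq N S (rep (collapse N m w)) w"
          using collapse_eq_iff[OF XD(1)[OF r(1)] XD(1)[OF w]] r(2) by blast
        then show ?thesis using VD(2)[OF \<phi> r(1) w] True by simp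
      next
        case False
        then show ?thesis using VD(1)[OF \<phi> w] collapse_in_Y_iff[OF w] by simp
      qed
      finally show ?thesis by simp
    qed
  qed
  also have "\<dots> = (\<Sum>f\<in>Y m. if compose N f g = f then 1 else 0)"
    by (intro sum.cong refl) (simp add: b_def collapse_act[OF g(2)] rep(2))
  also have "\<dots> = of_nat (card {f \<in> Y m. compose N f g = f})"
    using finite_Y by (simp add: sum.If_cases Int_def)
  finally show ?thesis .
qed

end

end

section \<open>Descent compositions and the expansion in fundamentals\<close>

context digraph_numberings
begin

text \<open>0 and \<open>card N\<close> are adjoined because \<open>partial_sums\<close> keeps both
  end points; the descents of a numbering lie strictly between them.\<close>

definition descent_composition :: "('a \<Rightarrow> nat) \<Rightarrow> nat list" where
  "descent_composition w = (SOME \<alpha>. composition \<alpha> \<and> partial_sums \<alpha> = insert 0 (insert (card N) (D w)))"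

lemma descent_composition:
  assumes "w \<in> X"
  shows "composition (descent_composition w)"
    and "partial_sums (descent_composition w) = insert 0 (insert (card N) (D w))"
    and "sum_list (descent_composition w) = card N"
proof -
  have D: "D w \<subseteq> {1..<card N}" unfolding D_def by (rule descents_subset[OF XD(1)[OF assms]])
  have "\<exists>\<alpha>. composition \<alpha> \<and> partial_sums \<alpha> = insert 0 (insert (card N) (D w) - {0})"
    by (rule ex_composition_partial_sums) (use finite_subset[OF D] in auto)
  then have "\<exists>\<alpha>. composition \<alpha> \<and> partial_sums \<alpha> = insert 0 (insert (card N) (D w))" by simp
  from someI_ex[OF this]
  show *: "composition (descent_composition w)"
    "partial_sums (descent_composition w) = insert 0 (insert (card N) (D w))"
    unfolding descent_composition_def by auto
  show "sum_list (descent_composition w) = card N"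
  proof (rule antisym)
    have "sum_list (descent_composition w) \<in> insert 0 (insert (card N) (D w))"
      unfolding *(2)[symmetric] by (rule sum_list_in_partial_sums)
    moreover have "x \<le> card N" if "x \<in> insert 0 (insert (card N) (D w))" for x using that D by auto
    ultimately show "sum_list (descent_composition w) \<le> card N" by blast
    show "card N \<le> sum_list (descent_composition w)"
      by (rule partial_sums_le) (simp add: *(2))
  qed
qed

lemma descent_composition_eq_iff:
  assumes "w \<in> X" "w' \<in> X"
  shows "descent_composition w = descent_composition w' \<longleftrightarrow> D w = D w'"
proof
  assume "descent_composition w = descent_composition w'"
  then have eq: "insert 0 (insert (card N) (D w)) = insert 0 (insert (card N) (D w'))"
    using descent_composition(2)[OF assms(1)] descent_composition(2)[OF assms(2)] by simp
  have "D w \<subseteq> {1..<card N}" "D w' \<subseteq> {1..<card N}"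
    unfolding D_def by (intro descents_subset XD(1) assms)+
  then have "D w = insert 0 (insert (card N) (D w)) \<inter> {1..<card N}"
    "D w' = insert 0 (insert (card N) (D w')) \<inter> {1..<card N}" by auto
  then show "D w = D w'" using eq by simp
qed (simp add: descent_composition_def)

lemma qsym_F_descent_composition:
  assumes w: "w \<in> X"
  shows "qsym_F (descent_composition w) m = of_bool (0 \<notin> Poly_Mapping.keys m \<and>
    monomial_degree m = card N \<and> D w \<subseteq> range (monomial_level m))"
proof -
  \<comment> \<open>Both end points are levels of every monomial of degree \<open>card N\<close>, so
    the only condition left concerns \<open>D w\<close>.\<close>
  have "0 \<in> range (monomial_level m)" using monomial_level_0[of m] by (metis rangeI)
  moreover have "monomial_degree m \<in> range (monomial_level m)"
    using ex_monomial_level_top[of m] by (metis rangeI)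
  ultimately show ?thesis
    unfolding qsym_F_eq_levels descent_composition[OF w] by auto
qed

theorem F_effective_chromatic:
  assumes G: "group \<G>" and H: "carrier \<G> \<subseteq> digraph_aut G"
    and one: "\<one>\<^bsub>\<G>\<^esub> = (\<lambda>x\<in>N. x)"
    and mult: "\<And>g h. g \<in> carrier \<G> \<Longrightarrow> h \<in> carrier \<G> \<Longrightarrow> g \<otimes>\<^bsub>\<G>\<^esub> h = compose N g h"
  shows "F_effective \<G> (t_coeff k (chromatic G))"
proof -
  interpret group \<G> by (rule G)
  have ta: "triangular_action X R e \<G> act D V" by (rule triangular_action[OF H refl one mult])
  interpret triangular_action X R e \<G> act D V by (rule ta)
  \<comment> \<open>On \<open>X\<close>, equal compositions mean equal descent sets, so
    \<open>\<psi> \<alpha>\<close> is the trace of one diagonal block, or zero.\<close>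
  define \<psi> where "\<psi> \<alpha> g = (\<Sum>w | w \<in> X \<and> descent_composition w = \<alpha>. coeff_kernel g w w)" for \<alpha> g
  have eff: "effective_character \<G> (\<psi> \<alpha>)" for \<alpha>
  proof (cases "\<exists>w\<in>X. descent_composition w = \<alpha>")
    case True
    then obtain w where w: "w \<in> X" "descent_composition w = \<alpha>" by blast
    have "{v \<in> X. descent_composition v = \<alpha>} = {v \<in> X. D v = D w}"
      using descent_composition_eq_iff[OF _ w(1)] w(2) by auto
    then show ?thesis
      using effective_character_trace[OF G kernel_rep_block[OF one_closed, of "D w"]]
      unfolding \<psi>_def by simp
  next
    case False
    then have none: "{w \<in> X. descent_composition w = \<alpha>} = {}" by blast
    show ?thesis
      by (rule effective_character_cong[OF effective_character_zero]) (simp only: \<psi>_def none sum.empty)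
  qed
  have "F_expansion (t_coeff k (chromatic G) g) (\<lambda>\<alpha>. \<psi> \<alpha> g)" if g: "g \<in> carrier \<G>" for g
  proof (rule F_expansionI[of "descent_composition ` X"])
    show "finite (descent_composition ` X)" using finite_X by simp
    show "composition \<alpha>" if "\<alpha> \<in> descent_composition ` X" for \<alpha> using that descent_composition(1) by auto
    show "\<alpha> \<in> descent_composition ` X" if "\<psi> \<alpha> g \<noteq> 0" for \<alpha>
    proof (rule ccontr)
      assume "\<alpha> \<notin> descent_composition ` X"
      then have none: "{w \<in> X. descent_composition w = \<alpha>} = {}" by blast
      have "\<psi> \<alpha> g = 0" by (simp only: \<psi>_def none sum.empty)
      then show False using that by simp
    qed
    fix m
    have "(\<Sum>\<alpha>\<in>descent_composition ` X. \<psi> \<alpha> g * qsym_F \<alpha> m) =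
        (\<Sum>\<alpha>\<in>descent_composition ` X. \<Sum>w | w \<in> X \<and> descent_composition w = \<alpha>.
          coeff_kernel g w w * qsym_F (descent_composition w) m)"
      by (intro sum.cong refl) (simp add: \<psi>_def sum_distrib_right)
    also have "\<dots> = (\<Sum>w\<in>X. coeff_kernel g w w * qsym_F (descent_composition w) m)"
      by (rule sum.image_gen[OF finite_X, symmetric])
    also have "\<dots> = t_coeff k (chromatic G) g m"
    proof (cases "0 \<notin> Poly_Mapping.keys m \<and> monomial_degree m = card N")
      case True
      have "(\<Sum>w\<in>X. coeff_kernel g w w * qsym_F (descent_composition w) m) =
          (\<Sum>w | w \<in> X \<and> D w \<subseteq> range (monomial_level m). coeff_kernel g w w)"
        using True finite_X
        by (intro sum.mono_neutral_cong_right) (auto simp: qsym_F_descent_composition)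
      also have "\<dots> = t_coeff k (chromatic G) g m"
        unfolding t_coeff_chromatic by (rule fixed_colorings[OF _ _ ta g]) (use True g H in auto)
      finally show ?thesis .
    next
      \<comment> \<open>No coloring has such a monomial, and it occurs in none of the fundamentals
        involved.\<close>
      case False
      then have "Y m = {}" using Y_monomial by blast
      moreover have "(\<Sum>w\<in>X. coeff_kernel g w w * qsym_F (descent_composition w) m) = 0"
        using False by (intro sum.neutral) (auto simp: qsym_F_descent_composition)
      ultimately show ?thesis by (simp add: t_coeff_chromatic)
    qed
    finally show "t_coeff k (chromatic G) g m = (\<Sum>\<alpha>\<in>descent_composition ` X. \<psi> \<alpha> g * qsym_F \<alpha> m)"
      by (rule sym)
  qed
  then show ?thesis unfolding F_effective_def using eff by (intro exI[of _ \<psi>]) simp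
qed

end

theorem theorem7p3:
  fixes G :: "'a pair_pre_digraph" and H :: "('a \<Rightarrow> 'a) set" and k :: nat
  assumes "pair_fin_digraph G"
    and "antisym (parcs G)"
    and "subgroup H (digraph_aut_group G)"
  shows "F_effective ((digraph_aut_group G)\<lparr>carrier := H\<rparr>) (t_coeff k (chromatic G)) \<and>
    (\<forall>\<psi>\<in>irreducible_characters ((digraph_aut_group G)\<lparr>carrier := H\<rparr>).
      F_positive (char_inner ((digraph_aut_group G)\<lparr>carrier := H\<rparr>) \<psi> (t_coeff k (chromatic G))))"
proof -
  let ?\<G> = "(digraph_aut_group G)\<lparr>carrier := H\<rparr>"
  interpret digraph_numberings G k
  proof
    show "finite (pverts G)" by (rule pair_fin_digraph.pair_finite_verts[OF assms(1)])
    show "u \<in> pverts G \<and> v \<in> pverts G" if "(u, v) \<in> parcs G" for u v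
      using pair_wf_digraph.wellformed'[OF pair_fin_digraph.axioms(1)[OF assms(1)]] that by blast
  qed
  have G: "group ?\<G>" by (rule group.subgroup_imp_group[OF group_digraph_aut_group assms(3)])
  have H: "H \<subseteq> digraph_aut G"
    using subgroup.subset[OF assms(3)] by (simp add: digraph_aut_group_def)
  have HB: "g \<in> Bij (pverts G)" if "g \<in> H" for g using H digraph_autD(1) that by blast
  \<comment> \<open>\<open>H\<close> consists of extensional self-maps of a finite set, so the group
    is finite, as averaging over it requires.\<close>
  have "finite (pverts G \<rightarrow>\<^sub>E pverts G)" using finite_verts by (simp add: finite_PiE)
  moreover have "H \<subseteq> pverts G \<rightarrow>\<^sub>E pverts G"
  proof
    fix g assume "g \<in> H"
    from Bij_imp_extensional[OF HB[OF this]] Bij_imp_funcset[OF HB[OF this]]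
    show "g \<in> pverts G \<rightarrow>\<^sub>E pverts G" by (simp add: PiE_def)
  qed
  ultimately have fin: "finite (carrier ?\<G>)" using finite_subset by auto
  have "F_effective ?\<G> (t_coeff k (chromatic G))"
  proof (rule F_effective_chromatic[OF G])
    show "g \<otimes>\<^bsub>?\<G>\<^esub> h = compose (pverts G) g h" if "g \<in> carrier ?\<G>" "h \<in> carrier ?\<G>" for g h
      using that HB by (simp add: digraph_aut_group_def BijGroup_def)
  qed (use H in \<open>simp_all add: digraph_aut_group_def BijGroup_def\<close>)
  then show ?thesis using F_effective_imp_F_positive[OF G fin] by blast
qed

end
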